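(* Let $F:S_n(\mathbb{R})\to\mathbb{R}$ be an admissible operator, let $H\in C(\mathbb{R}^n)$ be an admissible gradient constraint with support function $\ell$, and let $f:\mathbb{R}^n\to\mathbb{R}$ be convex and superlinear. Let $\lambda^*$ be the associated eigenvalue. Define $$\lambda_+:=\inf\left\{\sup_{x:\,H(D\psi(x))<0}\{-F(D^2\psi(x))+f(x)\}\;:\;\psi\in C^2(\mathbb{R}^n),\ \liminf_{|x|\to\infty}\frac{\psi(x)}{\ell(x)}\ge1\right\}$$ and $$\lambda_-:=\sup\left\{\inf_{x\in\mathbb{R}^n}\{-F(D^2\phi(x))+f(x)\}\;:\;\phi\in C^2(\mathbb{R}^n),\ H(D\phi)\le0\text{ on }\mathbb{R}^n\right\}.$$ Then $$\lambda_-\le\lambda^*\le\lambda_+.$$ If there is an eigenfunction $u^*$ that satisfies $D^2u^*\in L^\infty(\mathbb{R}^n;S_n(\mathbb{R}))$, then $\lambda^*=\lambda_+$.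
   Context: $S_n(\mathbb{R})$ is the space of real symmetric $n\times n$ matrices. $F:S_n(\mathbb{R})\to\mathbb{R}$ is an admissible operator if there are constants $\theta,\Theta\ge0$ such that for all $M,N\in S_n(\mathbb{R})$ and $t\ge0$: $-\Theta\,\mathrm{tr}N\le F(M+N)-F(M)\le-\theta\,\mathrm{tr}N$ whenever $N\ge0$; $F(tM)=tF(M)$; $F(M)+F(N)\le F(M+N)$. $H\in C(\mathbb{R}^n)$ is an admissible gradient constraint if $H(0)<0$ and the set $\{p\in\mathbb{R}^n:H(p)\le0\}$ is compact and strictly convex. Its support function is $\ell(v)=\max\{p\cdot v:H(p)\le0\}$. $f$ is superlinear if $\lim_{|x|\to\infty}f(x)/|x|=\infty$. The eigenvalue $\lambda^*$ is the unique real number $\lambda$ for which $\max\{\lambda+F(D^2u)-f(x),H(Du)\}=0$ in $\mathbb{R}^n$ has a viscosity solution $u\in C(\mathbb{R}^n)$ with $\lim_{|x|\to\infty}u(x)/\ell(x)=1$ (the paper establishes existence and uniqueness of $\lambda^*$ under these assumptions). Any such solution for $\lambda=\lambda^*$ is called an eigenfunction.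
   Formalization: Strict convexity of {H ≤ 0} is taken to mean that open segments between its points lie in {H < 0}, so H cannot vanish in the interior; otherwise the claim fails, e.g. n=1, F=-tr, f=x², H=max(|p|-1,0)+min(|p|-1/2,0), where λ₋ > λ₊. *)

theory Defs
  imports "HOL-Analysis.Analysis"
begin

section \<open>Calculus on \<open>\<real>\<^sup>n\<close>\<close>

definition partial :: "'n \<Rightarrow> (real^'n::finite \<Rightarrow> real) \<Rightarrow> real^'n \<Rightarrow> real" where
  "partial i \<phi> x = frechet_derivative \<phi> (at x) (axis i 1)"

definition grad :: "(real^'n::finite \<Rightarrow> real) \<Rightarrow> real^'n \<Rightarrow> real^'n" where
  "grad \<phi> x = (\<chi> i. partial i \<phi> x)"

definition hessian :: "(real^'n::finite \<Rightarrow> real) \<Rightarrow> real^'n \<Rightarrow> real^'n^'n" where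
  "hessian \<phi> x = (\<chi> i j. partial i (partial j \<phi>) x)"

primrec Ck :: "nat \<Rightarrow> (real^'n::finite \<Rightarrow> real) \<Rightarrow> bool" where
  "Ck 0 \<phi> \<longleftrightarrow> continuous_on UNIV \<phi>"
| "Ck (Suc k) \<phi> \<longleftrightarrow> (\<forall>x. \<phi> differentiable (at x)) \<and> (\<forall>i. Ck k (partial i \<phi>))"

abbreviation C2 :: "(real^'n::finite \<Rightarrow> real) \<Rightarrow> bool" where
  "C2 \<phi> \<equiv> Ck 2 \<phi>"

definition test_function :: "(real^'n::finite \<Rightarrow> real) \<Rightarrow> bool" where
  "test_function \<phi> \<longleftrightarrow> (\<forall>k. Ck k \<phi>) \<and> compact (closure {x. \<phi> x \<noteq> 0})"

text \<open>\<open>D\<^sup>2u \<in> L\<^sup>\<infinity>(\<real>\<^sup>n; S\<^sub>n(\<real>))\<close>, where \<open>D\<^sup>2u\<close> is the distributional Hessian of the (continuous)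
  function \<open>u\<close>.\<close>

definition bounded_weak_hessian :: "(real^'n::finite \<Rightarrow> real) \<Rightarrow> bool" where
  "bounded_weak_hessian u \<longleftrightarrow>
    (\<exists>A :: real^'n \<Rightarrow> real^'n^'n.
      A \<in> borel_measurable lborel \<and>
      (\<forall>x. transpose (A x) = A x) \<and>
      (\<exists>C. AE x in lborel. norm (A x) \<le> C) \<and>
      (\<forall>\<phi> i j. test_function \<phi> \<longrightarrow>
        (LINT x|lborel. u x * hessian \<phi> x $ i $ j) = (LINT x|lborel. A x $ i $ j * \<phi> x)))"

section \<open>The data \<open>F\<close>, \<open>H\<close>, \<open>f\<close>\<close>

abbreviation sym_mat :: "real^'n^'n \<Rightarrow> bool" where
  "sym_mat M \<equiv> transpose M = M"

definition psd :: "real^'n^'n \<Rightarrow> bool" where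
  "psd N \<longleftrightarrow> sym_mat N \<and> (\<forall>v. 0 \<le> v \<bullet> (N *v v))"

text \<open>An operator on \<open>S\<^sub>n(\<real>)\<close> is a function on all matrices of which only the values at symmetric
  matrices are constrained or used (the Hessian of a \<open>C\<^sup>2\<close> function is symmetric).\<close>

definition admissible_operator :: "(real^'n^'n \<Rightarrow> real) \<Rightarrow> bool" where
  "admissible_operator F \<longleftrightarrow>
    (\<exists>\<theta> \<Theta>. 0 \<le> \<theta> \<and> 0 \<le> \<Theta> \<and>
      (\<forall>M N. sym_mat M \<longrightarrow> psd N \<longrightarrow>
        - \<Theta> * trace N \<le> F (M + N) - F M \<and> F (M + N) - F M \<le> - \<theta> * trace N)) \<and>
    (\<forall>M t. sym_mat M \<longrightarrow> 0 \<le> t \<longrightarrow> F (t *\<^sub>R M) = t * F M) \<and>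
    (\<forall>M N. sym_mat M \<longrightarrow> sym_mat N \<longrightarrow> F M + F N \<le> F (M + N))"

text \<open>Strict convexity is required of the sublevel set \<open>{p. H p \<le> 0}\<close> as given by \<open>H\<close>: open segments
  between its points lie where the constraint is strict, \<open>H < 0\<close>. As
  \<open>admissible_gradient_constraint_iff\<close> below shows, this is strict convexity of the set together
  with \<open>H < 0\<close> throughout its interior. If \<open>H\<close> could vanish inside the set, the eigenvalue would not
  be unique: for \<open>n = 1\<close>, \<open>F M = - tr M\<close>, \<open>f x = x\<^sup>2\<close> and
  \<open>H p = max (\<bar>p\<bar> - 1) 0 + min (\<bar>p\<bar> - 1/2) 0\<close>, every \<open>\<lambda>\<close> in \<open>[(3/4) powr (2/3), (3/2) powr (2/3)]\<close>
  would be an eigenvalue.\<close>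

definition admissible_gradient_constraint :: "(real^'n::finite \<Rightarrow> real) \<Rightarrow> bool" where
  "admissible_gradient_constraint H \<longleftrightarrow>
    continuous_on UNIV H \<and> H 0 < 0 \<and> compact {p. H p \<le> 0} \<and>
    (\<forall>p q. H p \<le> 0 \<longrightarrow> H q \<le> 0 \<longrightarrow> open_segment p q \<subseteq> {r. H r < 0})"

lemma admissible_gradient_constraint_iff:
  fixes H :: "real^'n::finite \<Rightarrow> real"
  shows "admissible_gradient_constraint H \<longleftrightarrow>
    continuous_on UNIV H \<and> H 0 < 0 \<and> compact {p. H p \<le> 0} \<and>
    (\<forall>p\<in>{p. H p \<le> 0}. \<forall>q\<in>{p. H p \<le> 0}. open_segment p q \<subseteq> interior {p. H p \<le> 0}) \<and>
    interior {p. H p \<le> 0} = {p. H p < 0}" (is "?L \<longleftrightarrow> ?R")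
proof
  assume L: ?L
  then have cont: "continuous_on UNIV H" and H0: "H 0 < 0"
    and seg: "\<And>p q. H p \<le> 0 \<Longrightarrow> H q \<le> 0 \<Longrightarrow> open_segment p q \<subseteq> {r. H r < 0}"
    by (auto simp: admissible_gradient_constraint_def)
  have "open {p. H p < 0}"
    using cont by (intro open_Collect_less) auto
  then have 1: "{p. H p < 0} \<subseteq> interior {p. H p \<le> 0}"
    by (intro interior_maximal) auto
  have 2: "interior {p. H p \<le> 0} \<subseteq> {p. H p < 0}"
  proof
    fix p assume "p \<in> interior {p. H p \<le> 0}"
    then obtain e where e: "e > 0" "cball p e \<subseteq> {p. H p \<le> 0}"
      unfolding mem_interior_cball by blast
    show "p \<in> {p. H p < 0}"
    proof (cases "p = 0")
      case False
      define d where "d = e / norm p"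
      have d: "d > 0" using e False by (simp add: d_def)
      have "(1 + d) *\<^sub>R p \<in> cball p e"
        using False e by (simp add: dist_norm d_def algebra_simps)
      then have "H ((1 + d) *\<^sub>R p) \<le> 0" using e by blast
      moreover have "p \<in> open_segment 0 ((1 + d) *\<^sub>R p)"
        unfolding in_segment using d False
        by (auto intro!: exI[of _ "1 / (1 + d)"] simp: add_pos_pos)
      ultimately show ?thesis using seg[of 0 "(1 + d) *\<^sub>R p"] H0 by auto
    qed (use H0 in simp)
  qed
  show ?R
    using L 1 2 unfolding admissible_gradient_constraint_def by blast
qed (auto simp: admissible_gradient_constraint_def)

text \<open>For an admissible constraint the supremum is a maximum, by compactness.\<close>

definition support_fun :: "(real^'n::finite \<Rightarrow> real) \<Rightarrow> real^'n \<Rightarrow> real" where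
  "support_fun H v = (SUP p\<in>{p. H p \<le> 0}. p \<bullet> v)"

definition superlinear :: "(real^'n::finite \<Rightarrow> real) \<Rightarrow> bool" where
  "superlinear f \<longleftrightarrow> filterlim (\<lambda>x. f x / norm x) at_top at_infinity"

section \<open>Viscosity solutions of \<open>max {\<lambda> + F(D\<^sup>2u) - f(x), H(Du)} = 0\<close> and eigenvalues\<close>

definition pde_op ::
    "(real^'n^'n \<Rightarrow> real) \<Rightarrow> (real^'n \<Rightarrow> real) \<Rightarrow> (real^'n \<Rightarrow> real) \<Rightarrow> real \<Rightarrow>
      (real^'n::finite \<Rightarrow> real) \<Rightarrow> real^'n \<Rightarrow> real" where
  "pde_op F H f lam \<phi> x = max (lam + F (hessian \<phi> x) - f x) (H (grad \<phi> x))"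

definition viscosity_subsolution ::
    "(real^'n^'n \<Rightarrow> real) \<Rightarrow> (real^'n \<Rightarrow> real) \<Rightarrow> (real^'n \<Rightarrow> real) \<Rightarrow> real \<Rightarrow>
      (real^'n::finite \<Rightarrow> real) \<Rightarrow> bool" where
  "viscosity_subsolution F H f lam u \<longleftrightarrow>
    (\<forall>\<phi> x0. C2 \<phi> \<longrightarrow> (\<forall>\<^sub>F x in nhds x0. u x - \<phi> x \<le> u x0 - \<phi> x0) \<longrightarrow> pde_op F H f lam \<phi> x0 \<le> 0)"

definition viscosity_supersolution ::
    "(real^'n^'n \<Rightarrow> real) \<Rightarrow> (real^'n \<Rightarrow> real) \<Rightarrow> (real^'n \<Rightarrow> real) \<Rightarrow> real \<Rightarrow>
      (real^'n::finite \<Rightarrow> real) \<Rightarrow> bool" where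
  "viscosity_supersolution F H f lam u \<longleftrightarrow>
    (\<forall>\<phi> x0. C2 \<phi> \<longrightarrow> (\<forall>\<^sub>F x in nhds x0. u x - \<phi> x \<ge> u x0 - \<phi> x0) \<longrightarrow> pde_op F H f lam \<phi> x0 \<ge> 0)"

definition eigenfunction ::
    "(real^'n^'n \<Rightarrow> real) \<Rightarrow> (real^'n \<Rightarrow> real) \<Rightarrow> (real^'n \<Rightarrow> real) \<Rightarrow> real \<Rightarrow>
      (real^'n::finite \<Rightarrow> real) \<Rightarrow> bool" where
  "eigenfunction F H f lam u \<longleftrightarrow>
    continuous_on UNIV u \<and>
    viscosity_subsolution F H f lam u \<and> viscosity_supersolution F H f lam u \<and>
    ((\<lambda>x. u x / support_fun H x) \<longlongrightarrow> 1) at_infinity"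

definition is_eigenvalue ::
    "(real^'n^'n \<Rightarrow> real) \<Rightarrow> (real^'n \<Rightarrow> real) \<Rightarrow> (real^'n::finite \<Rightarrow> real) \<Rightarrow> real \<Rightarrow> bool" where
  "is_eigenvalue F H f lam \<longleftrightarrow> (\<exists>u. eigenfunction F H f lam u)"

section \<open>The minimax quantities\<close>

text \<open>Both are extended reals, since the inner supremum and infimum may be infinite.\<close>

definition lambda_plus ::
    "(real^'n^'n \<Rightarrow> real) \<Rightarrow> (real^'n \<Rightarrow> real) \<Rightarrow> (real^'n::finite \<Rightarrow> real) \<Rightarrow> ereal" where
  "lambda_plus F H f =
    (INF \<psi>\<in>{\<psi>. C2 \<psi> \<and> 1 \<le> Liminf at_infinity (\<lambda>x. ereal (\<psi> x / support_fun H x))}.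
      SUP x\<in>{x. H (grad \<psi> x) < 0}. ereal (- F (hessian \<psi> x) + f x))"

definition lambda_minus ::
    "(real^'n^'n \<Rightarrow> real) \<Rightarrow> (real^'n \<Rightarrow> real) \<Rightarrow> (real^'n::finite \<Rightarrow> real) \<Rightarrow> ereal" where
  "lambda_minus F H f =
    (SUP \<phi>\<in>{\<phi>. C2 \<phi> \<and> (\<forall>x. H (grad \<phi> x) \<le> 0)}.
      INF x. ereal (- F (hessian \<phi> x) + f x))"

end

theory Submission
  imports Defs
begin

text \<open>The inequalities compare an eigenfunction \<open>u\<close> with a scaled competitor: \<open>u - t \<phi>\<close> attains its
  minimum and \<open>u - \<psi> / t\<close> its maximum for \<open>0 < t < 1\<close>, strict convexity of \<open>{H \<le> 0}\<close> makes the
  gradient constraint strict at the contact point, and \<open>t\<close> tends to \<open>1\<close>.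

  For the equality, \<open>\<psi> = s U\<close> with \<open>s > 1\<close> and \<open>U\<close> a mollification of \<open>u\<close> at a small scale \<open>\<epsilon>\<close> is
  nearly optimal. Where \<open>H (D\<psi>) < 0\<close>, the gradient of \<open>U\<close> lies in the compact subset
  \<open>s\<inverse> {H \<le> 0}\<close> of \<open>{H < 0}\<close>, so the constraint is inactive throughout the \<open>\<epsilon>\<close>-ball and
  \<open>f - \<lambda> \<le> F (D\<^sup>2u)\<close> holds there almost everywhere, by touching \<open>u\<close> from below with quadratics near
  Lebesgue points of \<open>D\<^sup>2u\<close>. As \<open>F\<close> is concave and \<open>f\<close> convex, Jensen's inequality carries this over
  to \<open>U\<close>.\<close>

subsection \<open>Gradient, Hessian and Taylor's formula\<close>

text \<open>Without the factor \<open>t\<close> the compared functions may grow at the same rate,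
  and their difference need not attain an extremum; with it the difference dominates a positive
  multiple of \<open>support_fun H\<close> near infinity. Homogeneity turns
  \<open>F (t *\<^sub>R M)\<close> into \<open>t * F M\<close>, but \<open>f\<close> does not scale:
  the mismatch is paid with \<open>(1 - t) * m\<close>, where \<open>m\<close> is a lower bound of
  \<open>f\<close>, and disappears as \<open>t\<close> tends to 1.

  For the equality, an eigenfunction with bounded weak Hessian is in general not C2 and hence no
  competitor itself. Its viscosity inequality speaks of test functions and must become an inequality
  for the weak Hessian before it can be averaged. Gradients and Hessians are taken of mollifications
  only; \<open>u\<close> enters through its values and through bounds whose constant
  \<open>C\<close> is the same for all kernels. The factor \<open>s > 1\<close> does two things: it
  keeps the growth condition, as \<open>\<psi>\<close> divided by the support function tends to
  \<open>s\<close>, and by compactness it leaves a margin \<eta> independent of the point, so that a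
  single scale \<epsilon> serves the whole space.\<close>

lemma partial_eq:
  "(\<phi> has_derivative D) (at x) \<Longrightarrow> partial i \<phi> x = D (axis i 1)"
  by (simp add: partial_def frechet_derivative_at[symmetric])

lemma has_derivative_grad:
  fixes \<phi> :: "real^'n::finite \<Rightarrow> real"
  assumes "\<phi> differentiable (at x)"
  shows "(\<phi> has_derivative (\<lambda>h. grad \<phi> x \<bullet> h)) (at x)"
proof -
  obtain D where D: "(\<phi> has_derivative D) (at x)"
    using assms by (auto simp: differentiable_def)
  then interpret bounded_linear D by (rule has_derivative_bounded_linear)
  have "D h = grad \<phi> x \<bullet> h" for h
  proof -
    have "D h = D (\<Sum>i\<in>UNIV. h $ i *s axis i 1)"
      by (simp add: basis_expansion)
    also have "\<dots> = (\<Sum>i\<in>UNIV. h $ i * D (axis i 1))"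
      by (simp add: sum scale scalar_mult_eq_scaleR)
    also have "\<dots> = grad \<phi> x \<bullet> h"
      by (simp add: grad_def inner_vec_def partial_eq[OF D] mult.commute)
    finally show ?thesis .
  qed
  then show ?thesis using D by (metis (no_types, lifting) ext)
qed

lemma Ck_imp_continuous: "Ck k \<phi> \<Longrightarrow> continuous_on UNIV \<phi>"
  by (cases k) (auto intro!: differentiable_imp_continuous_on simp: differentiable_on_def
      intro: differentiable_at_withinI)

lemma C2_iff:
  "C2 \<phi> \<longleftrightarrow> (\<forall>x. \<phi> differentiable (at x)) \<and> (\<forall>i x. partial i \<phi> differentiable (at x)) \<and>
    (\<forall>i j. continuous_on UNIV (partial i (partial j \<phi>)))"
  by (auto simp: numeral_2_eq_2)

lemma C2_differentiable: "C2 \<phi> \<Longrightarrow> \<phi> differentiable (at x)"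
  by (simp add: C2_iff)

text \<open>The outer derivative of \<open>hessian\<close> pairs with \<open>h\<close> and the inner
  one with \<open>v\<close>; this is the form in which the chain rule along a line delivers second
  derivatives.\<close>

lemma hessian_quadratic_form:
  "(h::real^'n::finite) \<bullet> (hessian \<phi> x *v v) = (\<Sum>j\<in>UNIV. v $ j * (grad (partial j \<phi>) x \<bullet> h))"
proof -
  have "h \<bullet> (hessian \<phi> x *v v) = (\<Sum>i\<in>UNIV. \<Sum>j\<in>UNIV. v $ j * (partial i (partial j \<phi>) x * h $ i))"
    by (simp add: hessian_def inner_vec_def matrix_vector_mult_def sum_distrib_left algebra_simps)
  also have "\<dots> = (\<Sum>j\<in>UNIV. v $ j * (grad (partial j \<phi>) x \<bullet> h))"
    by (subst sum.swap) (simp add: grad_def inner_vec_def sum_distrib_left)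
  finally show ?thesis .
qed

lemma has_real_derivative_along_line:
  fixes \<phi> :: "real^'n::finite \<Rightarrow> real"
  assumes "\<phi> differentiable (at (c + t *\<^sub>R h))"
  shows "((\<lambda>t. \<phi> (c + t *\<^sub>R h)) has_real_derivative grad \<phi> (c + t *\<^sub>R h) \<bullet> h) (at t)"
proof -
  have "((\<lambda>t. c + t *\<^sub>R h) has_derivative (\<lambda>s. s *\<^sub>R h)) (at t)"
    by (auto intro!: derivative_eq_intros)
  from has_derivative_compose[OF this has_derivative_grad[OF assms]]
  show ?thesis by (simp add: has_field_derivative_def mult_commute_abs)
qed

lemma has_real_derivative_grad_along_line:
  fixes \<phi> :: "real^'n::finite \<Rightarrow> real"
  assumes "C2 \<phi>"
  shows "((\<lambda>t. grad \<phi> (c + t *\<^sub>R h) \<bullet> v) has_real_derivative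
    h \<bullet> (hessian \<phi> (c + t *\<^sub>R h) *v v)) (at t)"
proof -
  have "((\<lambda>t. \<Sum>j\<in>UNIV. v $ j * partial j \<phi> (c + t *\<^sub>R h)) has_real_derivative
      (\<Sum>j\<in>UNIV. v $ j * (grad (partial j \<phi>) (c + t *\<^sub>R h) \<bullet> h))) (at t)"
    using assms by (intro DERIV_sum DERIV_cmult has_real_derivative_along_line) (simp add: C2_iff)
  moreover have "grad \<phi> x \<bullet> v = (\<Sum>j\<in>UNIV. v $ j * partial j \<phi> x)" for x
    by (simp add: grad_def inner_vec_def mult.commute)
  ultimately show ?thesis by (simp add: hessian_quadratic_form)
qed

lemma mean_value_grad:
  fixes \<phi> :: "real^'n::finite \<Rightarrow> real"
  assumes "\<And>x. \<phi> differentiable (at x)"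
  obtains t where "0 < t" "t < 1" "\<phi> (c + h) - \<phi> c = grad \<phi> (c + t *\<^sub>R h) \<bullet> h"
  using MVT2[of 0 1 "\<lambda>t. \<phi> (c + t *\<^sub>R h)" "\<lambda>t. grad \<phi> (c + t *\<^sub>R h) \<bullet> h"]
    has_real_derivative_along_line[OF assms] by auto

text \<open>Pairing the increment with a fixed \<open>v\<close> keeps the mean value theorem scalar;
  choosing \<open>v\<close> as the increment itself later gives a Lipschitz bound.\<close>

lemma grad_mean_value:
  fixes \<phi> :: "real^'n::finite \<Rightarrow> real"
  assumes "C2 \<phi>"
  obtains t where "0 < t" "t < 1"
    "(grad \<phi> (c + h) - grad \<phi> c) \<bullet> v = h \<bullet> (hessian \<phi> (c + t *\<^sub>R h) *v v)"
  using MVT2[of 0 1 "\<lambda>t. grad \<phi> (c + t *\<^sub>R h) \<bullet> v" "\<lambda>t. h \<bullet> (hessian \<phi> (c + t *\<^sub>R h) *v v)"]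
    has_real_derivative_grad_along_line[OF assms] by (auto simp: inner_diff_left)

lemma Taylor2:
  fixes \<phi> :: "real^'n::finite \<Rightarrow> real"
  assumes "C2 \<phi>"
  obtains t where "0 < t" "t \<le> 1"
    "\<phi> (c + h) = \<phi> c + grad \<phi> c \<bullet> h + h \<bullet> (hessian \<phi> (c + t *\<^sub>R h) *v h) / 2"
proof -
  define d where "d = (\<lambda>m t. if m = (0::nat) then \<phi> (c + t *\<^sub>R h)
    else if m = 1 then grad \<phi> (c + t *\<^sub>R h) \<bullet> h else h \<bullet> (hessian \<phi> (c + t *\<^sub>R h) *v h))"
  have "DERIV (d m) t :> d (Suc m) t" if "m < 2" for m t
    using that has_real_derivative_grad_along_line[OF assms, of c h h t]
      has_real_derivative_along_line[OF C2_differentiable[OF assms], where c=c and t=t and h=h]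
    by (cases m) (auto simp: d_def)
  then obtain t where "0 < t" "t \<le> 1" "d 0 1 = (\<Sum>m<2. d m 0 / fact m * 1^m) + d 2 t / fact 2 * 1^2"
    using Maclaurin2[of 1 d "d 0" 2] by auto
  then show thesis
    by (intro that[of t]) (simp_all add: d_def numeral_2_eq_2)
qed

text \<open>Two applications of the mean value theorem, one per direction, to the second difference
  over a square of side \<open>s\<close>. The left side does not change when \<open>i\<close> and
  \<open>j\<close> are exchanged, the right side does.\<close>

lemma mixed_difference:
  fixes \<phi> :: "real^'n::finite \<Rightarrow> real"
  assumes "C2 \<phi>" "0 < s"
  obtains \<xi> \<eta> where "0 < \<xi>" "\<xi> < s" "0 < \<eta>" "\<eta> < s"
    "\<phi> (x + s *\<^sub>R axis i 1 + s *\<^sub>R axis j 1) - \<phi> (x + s *\<^sub>R axis i 1) - \<phi> (x + s *\<^sub>R axis j 1) + \<phi> x =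
      s\<^sup>2 * partial j (partial i \<phi>) (x + \<xi> *\<^sub>R axis i 1 + \<eta> *\<^sub>R axis j 1)"
proof -
  let ?a = "axis i 1 :: real^'n" and ?b = "axis j 1 :: real^'n"
  have ax: "grad g y \<bullet> axis k 1 = partial k g y" for g :: "real^'n \<Rightarrow> real" and y k
    by (simp add: grad_def inner_axis)
  have 1: "((\<lambda>t. \<phi> (x + s *\<^sub>R ?b + t *\<^sub>R ?a) - \<phi> (x + t *\<^sub>R ?a)) has_real_derivative
      partial i \<phi> (x + s *\<^sub>R ?b + t *\<^sub>R ?a) - partial i \<phi> (x + t *\<^sub>R ?a)) (at t)" for t
    using C2_differentiable[OF assms(1)]
    by (intro DERIV_diff) (auto intro: has_real_derivative_along_line simp flip: ax)
  obtain \<xi> where \<xi>: "0 < \<xi>" "\<xi> < s"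
    "\<phi> (x + s *\<^sub>R ?b + s *\<^sub>R ?a) - \<phi> (x + s *\<^sub>R ?a) - (\<phi> (x + s *\<^sub>R ?b) - \<phi> x) =
      s * (partial i \<phi> (x + s *\<^sub>R ?b + \<xi> *\<^sub>R ?a) - partial i \<phi> (x + \<xi> *\<^sub>R ?a))"
    using MVT2[OF assms(2) 1] by auto
  have 2: "((\<lambda>t. partial i \<phi> (x + \<xi> *\<^sub>R ?a + t *\<^sub>R ?b)) has_real_derivative
      partial j (partial i \<phi>) (x + \<xi> *\<^sub>R ?a + t *\<^sub>R ?b)) (at t)" for t
    using assms(1) has_real_derivative_along_line[of "partial i \<phi>" "x + \<xi> *\<^sub>R ?a" t ?b]
    by (simp add: C2_iff ax)
  obtain \<eta> where \<eta>: "0 < \<eta>" "\<eta> < s"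
    "partial i \<phi> (x + \<xi> *\<^sub>R ?a + s *\<^sub>R ?b) - partial i \<phi> (x + \<xi> *\<^sub>R ?a) =
      s * partial j (partial i \<phi>) (x + \<xi> *\<^sub>R ?a + \<eta> *\<^sub>R ?b)"
    using MVT2[OF assms(2) 2] by auto
  have 3: "x + s *\<^sub>R ?a + s *\<^sub>R ?b = x + s *\<^sub>R ?b + s *\<^sub>R ?a"
    "x + s *\<^sub>R ?b + \<xi> *\<^sub>R ?a = x + \<xi> *\<^sub>R ?a + s *\<^sub>R ?b" by simp_all
  show thesis
  proof (rule that[OF \<xi>(1,2) \<eta>(1,2)])
    show "\<phi> (x + s *\<^sub>R ?a + s *\<^sub>R ?b) - \<phi> (x + s *\<^sub>R ?a) - \<phi> (x + s *\<^sub>R ?b) + \<phi> x =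
      s\<^sup>2 * partial j (partial i \<phi>) (x + \<xi> *\<^sub>R ?a + \<eta> *\<^sub>R ?b)"
      using \<xi>(3) unfolding 3 \<eta>(3) power2_eq_square by linarith
  qed
qed

text \<open>Schwarz's theorem: both orders of differentiation represent the same second difference,
  at points that tend to \<open>x\<close>. It puts Hessians of C2 functions among the symmetric
  matrices, where admissibility of \<open>F\<close> has content.\<close>

lemma partial_commute:
  fixes \<phi> :: "real^'n::finite \<Rightarrow> real"
  assumes "C2 \<phi>"
  shows "partial i (partial j \<phi>) x = partial j (partial i \<phi>) x"
proof -
  let ?a = "axis i 1 :: real^'n" and ?b = "axis j 1 :: real^'n"
  define s where "s k = inverse (real (Suc k))" for k
  have s0: "s \<longlonglongrightarrow> 0" and spos: "\<And>k. s k > 0"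
    using LIMSEQ_inverse_real_of_nat by (auto simp: s_def[abs_def] simp del: of_nat_Suc)
  have "\<exists>\<xi> \<eta> \<xi>' \<eta>'. \<forall>k. 0 < \<xi> k \<and> \<xi> k < s k \<and> 0 < \<eta> k \<and> \<eta> k < s k \<and>
    0 < \<xi>' k \<and> \<xi>' k < s k \<and> 0 < \<eta>' k \<and> \<eta>' k < s k \<and>
    partial j (partial i \<phi>) (x + \<xi> k *\<^sub>R ?a + \<eta> k *\<^sub>R ?b) =
    partial i (partial j \<phi>) (x + \<xi>' k *\<^sub>R ?b + \<eta>' k *\<^sub>R ?a)"
  proof -
    have "\<exists>\<xi> \<eta> \<xi>' \<eta>'. 0 < \<xi> \<and> \<xi> < s k \<and> 0 < \<eta> \<and> \<eta> < s k \<and>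
      0 < \<xi>' \<and> \<xi>' < s k \<and> 0 < \<eta>' \<and> \<eta>' < s k \<and>
      partial j (partial i \<phi>) (x + \<xi> *\<^sub>R ?a + \<eta> *\<^sub>R ?b) =
      partial i (partial j \<phi>) (x + \<xi>' *\<^sub>R ?b + \<eta>' *\<^sub>R ?a)" for k
    proof -
      obtain \<xi> \<eta> where 1: "0 < \<xi>" "\<xi> < s k" "0 < \<eta>" "\<eta> < s k"
        "\<phi> (x + s k *\<^sub>R ?a + s k *\<^sub>R ?b) - \<phi> (x + s k *\<^sub>R ?a) - \<phi> (x + s k *\<^sub>R ?b) + \<phi> x =
          (s k)\<^sup>2 * partial j (partial i \<phi>) (x + \<xi> *\<^sub>R ?a + \<eta> *\<^sub>R ?b)"
        by (rule mixed_difference[OF assms spos[of k]])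
      obtain \<xi>' \<eta>' where 2: "0 < \<xi>'" "\<xi>' < s k" "0 < \<eta>'" "\<eta>' < s k"
        "\<phi> (x + s k *\<^sub>R ?b + s k *\<^sub>R ?a) - \<phi> (x + s k *\<^sub>R ?b) - \<phi> (x + s k *\<^sub>R ?a) + \<phi> x =
          (s k)\<^sup>2 * partial i (partial j \<phi>) (x + \<xi>' *\<^sub>R ?b + \<eta>' *\<^sub>R ?a)"
        by (rule mixed_difference[OF assms spos[of k]])
      have "x + s k *\<^sub>R ?b + s k *\<^sub>R ?a = x + s k *\<^sub>R ?a + s k *\<^sub>R ?b" by simp
      with 1(5) 2(5) have "(s k)\<^sup>2 * partial j (partial i \<phi>) (x + \<xi> *\<^sub>R ?a + \<eta> *\<^sub>R ?b) =
          (s k)\<^sup>2 * partial i (partial j \<phi>) (x + \<xi>' *\<^sub>R ?b + \<eta>' *\<^sub>R ?a)"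
        by (smt (verit))
      then have "partial j (partial i \<phi>) (x + \<xi> *\<^sub>R ?a + \<eta> *\<^sub>R ?b) =
          partial i (partial j \<phi>) (x + \<xi>' *\<^sub>R ?b + \<eta>' *\<^sub>R ?a)"
        using spos[of k] by simp
      with 1 2 show ?thesis by blast
    qed
    then show ?thesis by metis
  qed
  then obtain \<xi> \<eta> \<xi>' \<eta>' where *: "\<And>k. 0 < \<xi> k \<and> \<xi> k < s k" "\<And>k. 0 < \<eta> k \<and> \<eta> k < s k"
    "\<And>k. 0 < \<xi>' k \<and> \<xi>' k < s k" "\<And>k. 0 < \<eta>' k \<and> \<eta>' k < s k"
    and eq: "\<And>k. partial j (partial i \<phi>) (x + \<xi> k *\<^sub>R ?a + \<eta> k *\<^sub>R ?b) =
      partial i (partial j \<phi>) (x + \<xi>' k *\<^sub>R ?b + \<eta>' k *\<^sub>R ?a)" by metis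
  have lim0: "r \<longlonglongrightarrow> 0" if "\<And>k. 0 < r k \<and> r k < s k" for r
    using that by (intro tendsto_sandwich[OF _ _ tendsto_const s0]) (auto intro!: always_eventually less_imp_le)
  have lim: "(\<lambda>k. g (x + r k *\<^sub>R v + r' k *\<^sub>R w)) \<longlonglongrightarrow> g x"
    if "continuous_on UNIV g" "r \<longlonglongrightarrow> 0" "r' \<longlonglongrightarrow> 0" for g :: "real^'n \<Rightarrow> real" and r r' v w
  proof -
    have "(\<lambda>k. x + r k *\<^sub>R v + r' k *\<^sub>R w) \<longlonglongrightarrow> x + 0 *\<^sub>R v + 0 *\<^sub>R w"
      using that by (intro tendsto_intros)
    then show ?thesis
      using that(1) isCont_tendsto_compose[of x g] by (simp add: continuous_on_eq_continuous_at)
  qed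
  have "(\<lambda>k. partial j (partial i \<phi>) (x + \<xi> k *\<^sub>R ?a + \<eta> k *\<^sub>R ?b)) \<longlonglongrightarrow> partial j (partial i \<phi>) x"
    using assms by (intro lim lim0 *) (simp add: C2_iff)
  moreover have "(\<lambda>k. partial j (partial i \<phi>) (x + \<xi> k *\<^sub>R ?a + \<eta> k *\<^sub>R ?b)) \<longlonglongrightarrow> partial i (partial j \<phi>) x"
    unfolding eq using assms by (intro lim lim0 *) (simp add: C2_iff)
  ultimately show ?thesis by (rule LIMSEQ_unique[symmetric])
qed

lemma sym_mat_hessian: "C2 \<phi> \<Longrightarrow> sym_mat (hessian \<phi> x)"
  by (simp add: transpose_def hessian_def vec_eq_iff partial_commute)

lemma partial_cmult:
  assumes "\<phi> differentiable (at x)"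
  shows "partial i (\<lambda>x. c * \<phi> x) x = c * partial i \<phi> x"
  using has_derivative_mult_right[OF has_derivative_grad[OF assms], of c]
  by (simp add: partial_eq[OF has_derivative_grad[OF assms]] partial_eq)

lemma Ck_cmult: "Ck k \<phi> \<Longrightarrow> Ck k (\<lambda>x. c * \<phi> x)"
proof (induction k arbitrary: \<phi>)
  case (Suc k)
  then have "partial i (\<lambda>x. c * \<phi> x) = (\<lambda>x. c * partial i \<phi> x)" for i
    by (auto intro: partial_cmult)
  with Suc show ?case by simp
qed (auto intro: continuous_intros)

lemma grad_cmult: "\<phi> differentiable (at x) \<Longrightarrow> grad (\<lambda>x. c * \<phi> x) x = c *\<^sub>R grad \<phi> x"
  by (simp add: grad_def vec_eq_iff partial_cmult)

lemma hessian_cmult: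
  assumes "C2 \<phi>" shows "hessian (\<lambda>x. c * \<phi> x) x = c *\<^sub>R hessian \<phi> x"
proof -
  have "partial j (\<lambda>x. c * \<phi> x) = (\<lambda>x. c * partial j \<phi> x)" for j
    using assms by (auto simp: C2_iff partial_cmult)
  then show ?thesis
    using assms by (simp add: hessian_def vec_eq_iff partial_cmult C2_iff)
qed

lemma continuous_coercive_attains_inf:
  fixes g :: "'a::euclidean_space \<Rightarrow> real"
  assumes "continuous_on UNIV g" "filterlim g at_top at_infinity"
  obtains x0 where "\<And>x. g x0 \<le> g x"
proof -
  obtain b where b: "\<And>x. b \<le> norm x \<Longrightarrow> g 0 \<le> g x"
    using assms(2) unfolding filterlim_at_top eventually_at_infinity by metis
  have "\<exists>x\<in>cball 0 \<bar>b\<bar>. \<forall>y\<in>cball 0 \<bar>b\<bar>. g x \<le> g y"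
    using assms(1) by (intro continuous_attains_inf) (auto intro: continuous_on_subset)
  then obtain x0 where x0: "x0 \<in> cball 0 \<bar>b\<bar>" "\<And>y. y \<in> cball 0 \<bar>b\<bar> \<Longrightarrow> g x0 \<le> g y" by blast
  have "g x0 \<le> g x" for x
  proof (cases "norm x \<le> \<bar>b\<bar>")
    case False
    then have "g 0 \<le> g x" by (intro b) auto
    with x0(2)[of 0] show ?thesis by simp
  qed (use x0 in simp)
  then show thesis by (rule that)
qed

subsection \<open>The gradient constraint and its support function\<close>

lemma support_fun_upper:
  assumes "admissible_gradient_constraint H" "H p \<le> 0"
  shows "p \<bullet> v \<le> support_fun H v"
proof -
  have "compact ((\<lambda>p. p \<bullet> v) ` {p. H p \<le> 0})"
    using assms by (intro compact_continuous_image continuous_intros)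
      (simp add: admissible_gradient_constraint_def)
  then have "bdd_above ((\<lambda>p. p \<bullet> v) ` {p. H p \<le> 0})"
    by (intro bounded_imp_bdd_above compact_imp_bounded)
  then show ?thesis unfolding support_fun_def
    using assms(2) by (intro cSUP_upper) auto
qed

text \<open>A small ball around the origin lies in the sublevel set because \<open>H 0 < 0\<close>
  and \<open>H\<close> is continuous. Hence the support function is positive off the origin and
  coercive.\<close>

lemma support_fun_ge_norm:
  assumes "admissible_gradient_constraint (H :: real^'n::finite \<Rightarrow> real)"
  obtains r where "0 < r" "\<And>v. r * norm v \<le> support_fun H v"
proof -
  have "open {p. H p < 0}"
    using assms by (intro open_Collect_less) (auto simp: admissible_gradient_constraint_def)
  moreover have "0 \<in> {p. H p < 0}" using assms by (simp add: admissible_gradient_constraint_def)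
  ultimately obtain r where r: "r > 0" "cball 0 r \<subseteq> {p. H p < 0}"
    by (meson open_contains_cball)
  have "r * norm v \<le> support_fun H v" for v
  proof -
    \<comment> \<open>For \<open>v = 0\<close> the quotient is 0 by convention, and the point is the
      origin.\<close>
    have "(r / norm v) *\<^sub>R v \<in> cball 0 r" using r(1) by (cases "v = 0") simp_all
    then have "H ((r / norm v) *\<^sub>R v) \<le> 0" using r(2) less_imp_le by blast
    from support_fun_upper[OF assms this, of v] show ?thesis
      by (cases "v = 0") (simp_all add: dot_square_norm power2_eq_square)
  qed
  with r(1) show thesis by (rule that)
qed

lemma filterlim_support_fun:
  assumes "admissible_gradient_constraint (H :: real^'n::finite \<Rightarrow> real)"
  shows "filterlim (support_fun H) at_top at_infinity"
proof -
  obtain r where r: "0 < r" "\<And>v. r * norm v \<le> support_fun H v"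
    using support_fun_ge_norm[OF assms] by blast
  have "filterlim (\<lambda>v::real^'n. r * norm v) at_top at_infinity"
    using r(1) by (intro filterlim_tendsto_pos_mult_at_top[OF tendsto_const _ filterlim_norm_at_top])
  then show ?thesis by (rule filterlim_at_top_mono) (simp add: r)
qed

text \<open>Strict convexity applied to the segment from 0 to \<open>p\<close>. For
  \<open>p = 0\<close> that open segment is empty, and \<open>H 0 < 0\<close> takes its
  place.\<close>

lemma gradient_constraint_scale:
  assumes "admissible_gradient_constraint H" "H p \<le> 0" "0 < t" "t < 1"
  shows "H (t *\<^sub>R p) < 0"
proof (cases "p = 0")
  case False
  then have "t *\<^sub>R p \<in> open_segment 0 p"
    using assms by (auto simp: in_segment intro!: exI[of _ t])
  moreover have "H 0 \<le> 0" using assms(1) by (simp add: admissible_gradient_constraint_def)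
  ultimately show ?thesis
    using assms(1,2) unfolding admissible_gradient_constraint_def by blast
qed (use assms in \<open>simp add: admissible_gradient_constraint_def\<close>)

lemma superlinear_convex_bounded_below:
  fixes f :: "real^'n::finite \<Rightarrow> real"
  assumes "convex_on UNIV f" "superlinear f"
  obtains m where "\<And>x. m \<le> f x"
proof -
  have "filterlim f at_top at_infinity"
  proof -
    have "filterlim (\<lambda>x. f x / norm x * norm x) at_top at_infinity"
      using assms(2) unfolding superlinear_def
      by (rule filterlim_at_top_mult_at_top[OF _ filterlim_norm_at_top])
    moreover have "\<forall>\<^sub>F x in at_infinity. f x / norm x * norm x = f x"
      using eventually_not_equal_at_infinity[of 0] by eventually_elim simp
    ultimately show ?thesis by (simp cong: filterlim_cong)
  qed
  with assms(1) obtain x0 where "\<And>x. f x0 \<le> f x"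
    using continuous_coercive_attains_inf[of f] convex_on_continuous[of UNIV f] by auto
  then show thesis by (rule that)
qed

lemma operator_homogeneous:
  "admissible_operator F \<Longrightarrow> sym_mat M \<Longrightarrow> 0 \<le> t \<Longrightarrow> F (t *\<^sub>R M) = t * F M"
  by (simp add: admissible_operator_def)

text \<open>In every use \<open>c\<close> is a lower bound of \<open>f\<close>, and \<open>a\<close>
  and \<open>b\<close> are the quantities to be compared, one of which is the eigenvalue.\<close>

lemma le_of_scaled_bound:
  fixes a b c :: real
  assumes "\<And>t. 0 < t \<Longrightarrow> t < 1 \<Longrightarrow> t * a + (1 - t) * c \<le> b"
  shows "a \<le> b"
proof (rule tendsto_le[of "at_left 1" "\<lambda>_. b" b "\<lambda>t. t * a + (1 - t) * c"])
  show "((\<lambda>t. t * a + (1 - t) * c) \<longlongrightarrow> a) (at_left 1)"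
    by (rule tendsto_eq_intros refl | simp)+
  show "\<forall>\<^sub>F t in at_left 1. t * a + (1 - t) * c \<le> b"
    using eventually_at_left_real[of 0 "1::real"] assms by (auto elim: eventually_mono)
qed auto

subsection \<open>The two comparison inequalities\<close>

lemma lambda_minus_le:
  fixes F :: "real^'n::finite^'n \<Rightarrow> real"
  assumes F: "admissible_operator F" and H: "admissible_gradient_constraint H"
    and f: "convex_on UNIV f" "superlinear f" and ev: "is_eigenvalue F H f lam"
  shows "lambda_minus F H f \<le> ereal lam"
  unfolding lambda_minus_def
proof (rule SUP_least, clarify)
  fix \<phi> :: "real^'n \<Rightarrow> real" assume \<phi>: "C2 \<phi>" and H\<phi>: "\<forall>x. H (grad \<phi> x) \<le> 0"
  obtain u where u: "continuous_on UNIV u" "viscosity_supersolution F H f lam u"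
    "((\<lambda>x. u x / support_fun H x) \<longlongrightarrow> 1) at_infinity"
    using ev by (auto simp: is_eigenvalue_def eigenfunction_def)
  obtain m where m: "\<And>x. m \<le> f x" using superlinear_convex_bounded_below[OF f] by blast
  obtain r where r: "0 < r" "\<And>v. r * norm v \<le> support_fun H v"
    using support_fun_ge_norm[OF H] by blast
  have \<phi>le: "\<phi> x \<le> \<phi> 0 + support_fun H x" for x
  proof -
    obtain t where "\<phi> (0 + x) - \<phi> 0 = grad \<phi> (0 + t *\<^sub>R x) \<bullet> x"
      using mean_value_grad[OF C2_differentiable[OF \<phi>], of 0 x] by metis
    with support_fun_upper[OF H, of "grad \<phi> (0 + t *\<^sub>R x)" x] H\<phi> show ?thesis by auto
  qed
  \<comment> \<open>A real lower bound \<mu> stands for the extended real infimum, so that the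
    scaling argument stays within the reals.\<close>
  have bound: "\<mu> \<le> lam" if \<mu>: "\<And>x. \<mu> \<le> - F (hessian \<phi> x) + f x" for \<mu>
  proof (rule le_of_scaled_bound)
    fix t :: real assume t: "0 < t" "t < 1"
    define g where "g x = u x - t * \<phi> x" for x
    have "filterlim g at_top at_infinity"
    proof (rule filterlim_at_top_mono)
      show "filterlim (\<lambda>x. - (t * \<phi> 0) + (1 - t) / 2 * support_fun H x) at_top at_infinity"
        using t by (intro filterlim_tendsto_add_at_top[OF tendsto_const]
            filterlim_tendsto_pos_mult_at_top[OF tendsto_const _ filterlim_support_fun[OF H]]) auto
      \<comment> \<open>The midpoint of \<open>t\<close> and 1: \<phi> costs at most
        \<open>t\<close> times the support function, which leaves the share
        \<open>(1 - t) / 2\<close>.\<close>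
      have "\<forall>\<^sub>F x in at_infinity. (1 + t) / 2 < u x / support_fun H x"
        using t by (intro order_tendstoD[OF u(3)]) auto
      then show "\<forall>\<^sub>F x in at_infinity. - (t * \<phi> 0) + (1 - t) / 2 * support_fun H x \<le> g x"
        using eventually_not_equal_at_infinity[of 0]
      proof eventually_elim
        case (elim x)
        then have l: "0 < support_fun H x" using r(1) r(2)[of x]
          by (meson less_le_trans mult_pos_pos zero_less_norm_iff)
        with elim have "(1 + t) / 2 * support_fun H x < u x" by (simp add: field_simps)
        moreover have "t * \<phi> x \<le> t * (\<phi> 0 + support_fun H x)"
          using \<phi>le t by (intro mult_left_mono) auto
        ultimately show ?case unfolding g_def by (simp add: field_simps)
      qed
    qed
    moreover have "continuous_on UNIV g" unfolding g_def
      using u(1) Ck_imp_continuous[OF \<phi>] by (intro continuous_intros)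
    ultimately obtain x0 where x0: "\<And>x. g x0 \<le> g x"
      using continuous_coercive_attains_inf by metis
    have "pde_op F H f lam (\<lambda>x. t * \<phi> x) x0 \<ge> 0"
      using u(2) x0 Ck_cmult[OF \<phi>] unfolding viscosity_supersolution_def g_def by auto
    moreover have "H (grad (\<lambda>x. t * \<phi> x) x0) < 0"
      using gradient_constraint_scale[OF H _ t] H\<phi> by (simp add: grad_cmult C2_differentiable[OF \<phi>])
    moreover have "F (hessian (\<lambda>x. t * \<phi> x) x0) = t * F (hessian \<phi> x0)"
      using t operator_homogeneous[OF F sym_mat_hessian[OF \<phi>]] by (simp add: hessian_cmult[OF \<phi>])
    \<comment> \<open>The gradient entry of the maximum is negative, so the supersolution inequality
      must hold in the other entry.\<close>
    ultimately have *: "0 \<le> lam + t * F (hessian \<phi> x0) - f x0"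
      by (auto simp: pde_op_def max_def split: if_splits)
    have "t * \<mu> \<le> t * (- F (hessian \<phi> x0) + f x0)" using \<mu> t by (intro mult_left_mono) auto
    moreover have "(1 - t) * m \<le> (1 - t) * f x0" using m t by (intro mult_left_mono) auto
    ultimately show "t * \<mu> + (1 - t) * m \<le> lam" using * by (simp add: algebra_simps)
  qed
  show "(INF x. ereal (- F (hessian \<phi> x) + f x)) \<le> ereal lam"
  proof (rule ccontr)
    assume "\<not> ?thesis"
    then obtain \<mu> where "ereal lam < ereal \<mu>" "ereal \<mu> < (INF x. ereal (- F (hessian \<phi> x) + f x))"
      unfolding not_le by (blast dest: ereal_dense2)
    moreover have "\<mu> \<le> - F (hessian \<phi> x) + f x" for x
    proof -
      have "(INF x. ereal (- F (hessian \<phi> x) + f x)) \<le> ereal (- F (hessian \<phi> x) + f x)"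
        by (intro INF_lower) simp
      from \<open>ereal \<mu> < _\<close> this have "ereal \<mu> < ereal (- F (hessian \<phi> x) + f x)" by (rule less_le_trans)
      then show ?thesis by simp
    qed
    ultimately show False using bound[of \<mu>] by simp
  qed
qed

text \<open>The contact point has to belong to the set over which the inner supremum runs. The
  subsolution property provides this: \<open>H\<close> is at most 0 at the gradient of \<psi>
  divided by \<open>t\<close>, and shrinking by \<open>t\<close> makes it negative at the gradient
  itself.\<close>

lemma le_lambda_plus:
  fixes F :: "real^'n::finite^'n \<Rightarrow> real"
  assumes F: "admissible_operator F" and H: "admissible_gradient_constraint H"
    and f: "convex_on UNIV f" "superlinear f" and ev: "is_eigenvalue F H f lam"
  shows "ereal lam \<le> lambda_plus F H f"
  unfolding lambda_plus_def
proof (rule INF_greatest, clarify)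
  fix \<psi> :: "real^'n \<Rightarrow> real"
  assume \<psi>: "C2 \<psi>" and lim: "1 \<le> Liminf at_infinity (\<lambda>x. ereal (\<psi> x / support_fun H x))"
  obtain u where u: "continuous_on UNIV u" "viscosity_subsolution F H f lam u"
    "((\<lambda>x. u x / support_fun H x) \<longlongrightarrow> 1) at_infinity"
    using ev by (auto simp: is_eigenvalue_def eigenfunction_def)
  obtain m where m: "\<And>x. m \<le> f x" using superlinear_convex_bounded_below[OF f] by blast
  obtain r where r: "0 < r" "\<And>v. r * norm v \<le> support_fun H v"
    using support_fun_ge_norm[OF H] by blast
  have bound: "lam \<le> \<mu>" if \<mu>: "\<And>x. H (grad \<psi> x) < 0 \<Longrightarrow> - F (hessian \<psi> x) + f x \<le> \<mu>" for \<mu>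
  proof (rule le_of_scaled_bound)
    fix t :: real assume t: "0 < t" "t < 1"
    define g where "g x = \<psi> x / t - u x" for x
    have "filterlim g at_top at_infinity"
    proof (rule filterlim_at_top_mono)
      \<comment> \<open>Small enough that \<open>(1 - e) / t\<close> exceeds \<open>1 + e\<close>;
        near infinity \<psi> is above \<open>1 - e\<close> times and \<open>u\<close> below
        \<open>1 + e\<close> times the support function.\<close>
      define e where "e = (1 - t) / 3"
      have e: "0 < e" "t * (1 + e) < 1 - e"
      proof -
        show "0 < e" using t by (simp add: e_def)
        have "1 - e - t * (1 + e) = (1 - t) * (2 - t) / 3" by (simp add: e_def field_simps)
        moreover have "0 < (1 - t) * (2 - t) / 3" using t by simp
        ultimately show "t * (1 + e) < 1 - e" by linarith
      qed
      then have pos: "0 < (1 - e) / t - (1 + e)" using t by (simp add: field_simps)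
      show "filterlim (\<lambda>x. ((1 - e) / t - (1 + e)) * support_fun H x) at_top at_infinity"
        by (rule filterlim_tendsto_pos_mult_at_top[OF tendsto_const pos filterlim_support_fun[OF H]])
      have "\<forall>\<^sub>F x in at_infinity. u x / support_fun H x < 1 + e"
        using e by (intro order_tendstoD[OF u(3)]) auto
      moreover have "\<forall>\<^sub>F x in at_infinity. ereal (1 - e) < ereal (\<psi> x / support_fun H x)"
      proof -
        have "ereal (1 - e) < 1" using e(1) by simp
        then show ?thesis using lim unfolding le_Liminf_iff by blast
      qed
      ultimately show "\<forall>\<^sub>F x in at_infinity. ((1 - e) / t - (1 + e)) * support_fun H x \<le> g x"
        using eventually_not_equal_at_infinity[of 0]
      proof eventually_elim
        case (elim x)
        then have l: "0 < support_fun H x" using r(1) r(2)[of x]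
          by (meson less_le_trans mult_pos_pos zero_less_norm_iff)
        with elim have 1: "u x \<le> (1 + e) * support_fun H x" and "(1 - e) * support_fun H x \<le> \<psi> x"
          by (simp_all add: field_simps)
        then have "(1 - e) * support_fun H x / t \<le> \<psi> x / t"
          using t by (intro divide_right_mono) auto
        with 1 show ?case unfolding g_def by (simp add: algebra_simps)
      qed
    qed
    moreover have "continuous_on UNIV g" unfolding g_def
      using u(1) Ck_imp_continuous[OF \<psi>] t by (intro continuous_intros) auto
    ultimately obtain x0 where x0: "\<And>x. g x0 \<le> g x"
      using continuous_coercive_attains_inf by metis
    define c where "c = 1 / t"
    have c: "0 < c" "t * c = 1" using t by (simp_all add: c_def)
    have sub: "pde_op F H f lam (\<lambda>x. c * \<psi> x) x0 \<le> 0"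
    proof -
      have "u x - c * \<psi> x \<le> u x0 - c * \<psi> x0" for x using x0[of x] by (simp add: g_def c_def)
      then have "\<forall>\<^sub>F x in nhds x0. u x - c * \<psi> x \<le> u x0 - c * \<psi> x0" by (intro always_eventually allI)
      then show ?thesis
        using u(2) Ck_cmult[OF \<psi>, of c] unfolding viscosity_subsolution_def by blast
    qed
    then have "H (c *\<^sub>R grad \<psi> x0) \<le> 0"
      by (simp add: pde_op_def grad_cmult[OF C2_differentiable[OF \<psi>]])
    from gradient_constraint_scale[OF H this t] c(2) have "H (grad \<psi> x0) < 0" by simp
    from \<mu>[OF this] have \<mu>0: "- F (hessian \<psi> x0) + f x0 \<le> \<mu>" .
    have "F (hessian (\<lambda>x. c * \<psi> x) x0) = c * F (hessian \<psi> x0)"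
      using c operator_homogeneous[OF F sym_mat_hessian[OF \<psi>]] by (simp add: hessian_cmult[OF \<psi>])
    with sub have "lam + F (hessian \<psi> x0) / t \<le> f x0"
      by (simp add: pde_op_def c_def)
    then have "t * lam + F (hessian \<psi> x0) \<le> t * f x0" using t by (simp add: field_simps)
    moreover have "(1 - t) * m \<le> (1 - t) * f x0" using m t by (intro mult_left_mono) auto
    ultimately show "t * lam + (1 - t) * m \<le> \<mu>" using \<mu>0 by (simp add: algebra_simps)
  qed
  let ?S = "SUP x\<in>{x. H (grad \<psi> x) < 0}. ereal (- F (hessian \<psi> x) + f x)"
  show "ereal lam \<le> ?S"
  proof (rule ccontr)
    assume "\<not> ?thesis"
    then obtain \<mu> where "?S < ereal \<mu>" "ereal \<mu> < ereal lam"
      unfolding not_le by (blast dest: ereal_dense2)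
    moreover have "- F (hessian \<psi> x) + f x \<le> \<mu>" if "H (grad \<psi> x) < 0" for x
    proof -
      have "ereal (- F (hessian \<psi> x) + f x) \<le> ?S" using that by (intro SUP_upper) simp
      from this \<open>?S < ereal \<mu>\<close> have "ereal (- F (hessian \<psi> x) + f x) < ereal \<mu>" by (rule le_less_trans)
      then show ?thesis by simp
    qed
    ultimately show False using bound[of \<mu>] by simp
  qed
qed

subsection \<open>Test functions and mollifiers\<close>

text \<open>For \<open>m = 0\<close> this is the standard flat function. The extra powers of
  \<open>t\<close> make the family closed under differentiation up to linear combinations, so
  smoothness follows by induction.\<close>

definition flat_exp :: "nat \<Rightarrow> real \<Rightarrow> real" where
  "flat_exp m t = (if 0 < t then exp (- 1 / t) / t ^ m else 0)"

text \<open>This is the difference quotient at 0. From the right, the substitution of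
  \<open>inverse t\<close> turns it into a power divided by an exponential.\<close>

lemma flat_exp_div_tendsto_0: "((\<lambda>t. flat_exp m t / t) \<longlongrightarrow> 0) (at 0)"
  unfolding filterlim_at_split
proof
  have "\<forall>\<^sub>F t in at_left 0. (0::real) = flat_exp m t / t"
    using eventually_at_left_real[of "-1" "0::real"]
    by (auto simp: flat_exp_def elim!: eventually_mono)
  from Lim_transform_eventually[OF tendsto_const this]
  show "((\<lambda>t. flat_exp m t / t) \<longlongrightarrow> 0) (at_left 0)" .
  have "((\<lambda>t::real. inverse t ^ Suc m / exp (inverse t)) \<longlongrightarrow> 0) (at_right 0)"
    by (rule filterlim_compose[OF tendsto_power_div_exp_0 filterlim_inverse_at_top_right])
  moreover have "\<forall>\<^sub>F t in at_right 0. inverse t ^ Suc m / exp (inverse t) = flat_exp m t / t"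
    using eventually_at_right_real[of "0::real" 1]
    by (auto simp: flat_exp_def exp_minus field_simps elim!: eventually_mono)
  ultimately show "((\<lambda>t. flat_exp m t / t) \<longlongrightarrow> 0) (at_right 0)"
    by (rule Lim_transform_eventually)
qed

lemma flat_exp_has_real_derivative:
  "(flat_exp m has_real_derivative flat_exp (m + 2) t - m * flat_exp (m + 1) t) (at t)"
proof -
  consider "t < 0" | "t = 0" | "0 < t" by linarith
  then show ?thesis
  proof cases
    case 1
    have "((\<lambda>_. 0) has_real_derivative 0) (at t)" by simp
    then have "(flat_exp m has_real_derivative 0) (at t)"
      by (rule has_field_derivative_transform_within_open[where S = "{..<0}"])
        (use 1 in \<open>auto simp: flat_exp_def\<close>)
    with 1 show ?thesis by (simp add: flat_exp_def)
  next
    case 2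
    with flat_exp_div_tendsto_0[of m] show ?thesis
      by (simp add: has_field_derivative_iff flat_exp_def)
  next
    case 3
    have 1: "((\<lambda>t. exp (- 1 / t)) has_real_derivative exp (- 1 / t) / t\<^sup>2) (at t)"
      using 3 by (auto intro!: derivative_eq_intros simp: power2_eq_square)
    \<comment> \<open>At \<open>m = 0\<close> the subtraction truncates, but both sides carry the
      factor 0.\<close>
    have 2: "real m * t ^ (m - Suc 0) = real m * t ^ m / t"
      using 3 by (cases m) auto
    have "((\<lambda>t. exp (- 1 / t) / t ^ m) has_real_derivative
        (exp (- 1 / t) / t\<^sup>2 * t ^ m - exp (- 1 / t) * (real m * t ^ m / t)) / (t ^ m * t ^ m)) (at t)"
      using 3 DERIV_divide[OF 1 DERIV_pow[of m t]] unfolding 2 by simp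
    also have "(exp (- 1 / t) / t\<^sup>2 * t ^ m - exp (- 1 / t) * (real m * t ^ m / t)) / (t ^ m * t ^ m) =
        flat_exp (m + 2) t - m * flat_exp (m + 1) t"
      using 3 by (simp add: flat_exp_def power2_eq_square field_simps)
    finally have "((\<lambda>t. exp (- 1 / t) / t ^ m) has_real_derivative
        flat_exp (m + 2) t - m * flat_exp (m + 1) t) (at t)" .
    then show ?thesis
      by (rule has_field_derivative_transform_within_open[where S = "{0<..}"])
        (use 3 in \<open>auto simp: flat_exp_def\<close>)
  qed
qed

text \<open>A class of smooth functions supported in the ball of radius \<open>\<rho>\<close> that contains the standard
  bump and is closed under partial derivatives.\<close>

inductive bump :: "real \<Rightarrow> (real^'n::finite \<Rightarrow> real) \<Rightarrow> bool" for \<rho> where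
  flat: "bump \<rho> (\<lambda>x. flat_exp m (1 - x \<bullet> x / \<rho>\<^sup>2))"
| coord: "bump \<rho> \<phi> \<Longrightarrow> bump \<rho> (\<lambda>x. x $ i * \<phi> x)"
| add: "bump \<rho> \<phi> \<Longrightarrow> bump \<rho> \<psi> \<Longrightarrow> bump \<rho> (\<lambda>x. \<phi> x + \<psi> x)"
| cmult: "bump \<rho> \<phi> \<Longrightarrow> bump \<rho> (\<lambda>x. c * \<phi> x)"

text \<open>Differentiability and membership of the derivative in the class are proved together,
  since the product rule in the \<open>coord\<close> case needs both for the inner function.\<close>

lemma bump_derivative:
  fixes i :: "'n::finite"
  shows "bump \<rho> \<phi> \<Longrightarrow> \<exists>\<psi>. bump \<rho> \<psi> \<and> (\<forall>x. \<exists>D. (\<phi> has_derivative D) (at x) \<and> D (axis i 1) = \<psi> x)"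
proof (induction rule: bump.induct)
  case (flat m)
  \<comment> \<open>Chain rule: the factor in front is the \<open>i\<close>-th derivative of the
    inner quadratic, the bracket is the derivative of \<open>flat_exp m\<close>.\<close>
  define \<psi> where "\<psi> x = (- 2 / \<rho>\<^sup>2) * (x $ i * (flat_exp (m + 2) (1 - x \<bullet> x / \<rho>\<^sup>2) +
    - real m * flat_exp (m + 1) (1 - x \<bullet> x / \<rho>\<^sup>2)))" for x :: "real^'n"
  have "bump \<rho> \<psi>" unfolding \<psi>_def by (intro bump.intros)
  moreover have "\<exists>D. ((\<lambda>x. flat_exp m (1 - x \<bullet> x / \<rho>\<^sup>2)) has_derivative D) (at x) \<and>
      D (axis i 1) = \<psi> x" for x
  proof -
    have "((\<lambda>x. 1 - inverse (\<rho>\<^sup>2) * (x \<bullet> x)) has_derivative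
        (\<lambda>h. - (inverse (\<rho>\<^sup>2) * (2 * (x \<bullet> h))))) (at x)"
      by (auto intro!: derivative_eq_intros simp: inner_commute)
    then have 1: "((\<lambda>x. 1 - x \<bullet> x / \<rho>\<^sup>2) has_derivative (\<lambda>h. - (2 / \<rho>\<^sup>2) * (x \<bullet> h))) (at x)"
      by (simp add: divide_inverse mult.commute mult.left_commute)
    show ?thesis
      using has_derivative_compose[OF 1 flat_exp_has_real_derivative[unfolded has_field_derivative_def, of m]]
      by (intro exI conjI, assumption) (simp add: \<psi>_def inner_axis algebra_simps)
  qed
  ultimately show ?case by blast
next
  case (coord \<phi> k)
  then obtain \<psi> where \<psi>: "bump \<rho> \<psi>"
    "\<And>x. \<exists>D. (\<phi> has_derivative D) (at x) \<and> D (axis i 1) = \<psi> x" by blast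
  have "bump \<rho> (\<lambda>x. (if i = k then 1 else 0) * \<phi> x + x $ k * \<psi> x)"
    using coord(1) \<psi>(1) by (intro bump.intros)
  moreover have "\<exists>D. ((\<lambda>x. x $ k * \<phi> x) has_derivative D) (at x) \<and>
      D (axis i 1) = (if i = k then 1 else 0) * \<phi> x + x $ k * \<psi> x" for x
  proof -
    obtain D where D: "(\<phi> has_derivative D) (at x)" "D (axis i 1) = \<psi> x" using \<psi>(2) by blast
    have "((\<lambda>x. x $ k) has_derivative (\<lambda>h. h $ k)) (at x)"
      by (rule bounded_linear.has_derivative[OF bounded_linear_vec_nth has_derivative_ident])
    then show ?thesis using has_derivative_mult[OF _ D(1), of "\<lambda>x. x $ k"] D(2)
      by (intro exI[of _ "\<lambda>h. x $ k * D h + h $ k * \<phi> x"]) (auto simp: axis_def)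
  qed
  ultimately show ?case by blast
next
  case (add \<phi> \<phi>')
  then obtain \<psi> \<psi>' where \<psi>: "bump \<rho> \<psi>" "bump \<rho> \<psi>'"
    "\<And>x. \<exists>D. (\<phi> has_derivative D) (at x) \<and> D (axis i 1) = \<psi> x"
    "\<And>x. \<exists>D. (\<phi>' has_derivative D) (at x) \<and> D (axis i 1) = \<psi>' x" by blast
  have "\<exists>D. ((\<lambda>x. \<phi> x + \<phi>' x) has_derivative D) (at x) \<and> D (axis i 1) = \<psi> x + \<psi>' x" for x
  proof -
    obtain D D' where "(\<phi> has_derivative D) (at x)" "D (axis i 1) = \<psi> x"
      "(\<phi>' has_derivative D') (at x)" "D' (axis i 1) = \<psi>' x"
      using \<psi>(3,4) by blast
    then show ?thesis by (intro exI[of _ "\<lambda>h. D h + D' h"]) (auto intro: has_derivative_add)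
  qed
  with bump.add[OF \<psi>(1,2)] show ?case by blast
next
  case (cmult \<phi> c)
  then obtain \<psi> where \<psi>: "bump \<rho> \<psi>"
    "\<And>x. \<exists>D. (\<phi> has_derivative D) (at x) \<and> D (axis i 1) = \<psi> x" by blast
  have "\<exists>D. ((\<lambda>x. c * \<phi> x) has_derivative D) (at x) \<and> D (axis i 1) = c * \<psi> x" for x
  proof -
    obtain D where "(\<phi> has_derivative D) (at x)" "D (axis i 1) = \<psi> x" using \<psi>(2) by blast
    then show ?thesis by (intro exI[of _ "\<lambda>h. c * D h"]) (auto intro: has_derivative_mult_right)
  qed
  with bump.cmult[OF \<psi>(1)] show ?case by blast
qed

lemma bump_differentiable: "bump \<rho> \<phi> \<Longrightarrow> \<phi> differentiable (at x)"
  using bump_derivative unfolding differentiable_def by blast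

lemma bump_partial: "bump \<rho> \<phi> \<Longrightarrow> bump \<rho> (partial i \<phi>)"
proof -
  assume "bump \<rho> \<phi>"
  then obtain \<psi> where \<psi>: "bump \<rho> \<psi>" "\<And>x. \<exists>D. (\<phi> has_derivative D) (at x) \<and> D (axis i 1) = \<psi> x"
    using bump_derivative by blast
  then have "partial i \<phi> = \<psi>" using partial_eq by (metis ext)
  with \<psi>(1) show ?thesis by simp
qed

lemma Ck_bump: "bump \<rho> \<phi> \<Longrightarrow> Ck k \<phi>"
proof (induction k arbitrary: \<phi>)
  case 0
  then show ?case
    by (auto intro!: differentiable_imp_continuous_on
        simp: differentiable_on_def bump_differentiable differentiable_at_withinI)
next
  case (Suc k)
  then show ?case by (simp add: bump_differentiable bump_partial)
qed

lemma bump_eq_0: "bump \<rho> \<phi> \<Longrightarrow> 0 < \<rho> \<Longrightarrow> \<rho> \<le> norm x \<Longrightarrow> \<phi> x = 0"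
proof (induction rule: bump.induct)
  case (flat m)
  then have "\<rho>\<^sup>2 \<le> x \<bullet> x" by (simp add: dot_square_norm power_mono)
  with flat show ?case by (simp add: flat_exp_def)
qed auto

section \<open>Supports, derivatives and translates of test functions\<close>

lemma test_function_supported:
  fixes \<phi> :: "real^'n::finite \<Rightarrow> real"
  assumes "test_function \<phi>"
  obtains R where "0 < R" "\<And>x. R < norm x \<Longrightarrow> \<phi> x = 0"
proof -
  have "bounded (closure {x. \<phi> x \<noteq> 0})"
    using assms by (simp add: test_function_def compact_imp_bounded)
  then obtain R where R: "0 < R" "\<And>x. x \<in> closure {x. \<phi> x \<noteq> 0} \<Longrightarrow> norm x \<le> R"
    unfolding bounded_pos by blast
  have "\<phi> x = 0" if "R < norm x" for x
    using that R(2)[of x] closure_subset[of "{x. \<phi> x \<noteq> 0}"] by fastforce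
  with R(1) show thesis by (rule that)
qed

lemma test_functionI:
  fixes \<phi> :: "real^'n::finite \<Rightarrow> real"
  assumes "\<And>k. Ck k \<phi>" "\<And>x. R < norm x \<Longrightarrow> \<phi> x = 0"
  shows "test_function \<phi>"
proof -
  have "{x. \<phi> x \<noteq> 0} \<subseteq> cball 0 R" using assms(2) by (force simp: not_less[symmetric])
  then have "bounded {x. \<phi> x \<noteq> 0}" using bounded_subset bounded_cball by blast
  with assms(1) show ?thesis by (simp add: test_function_def)
qed

lemma test_function_differentiable: "test_function \<phi> \<Longrightarrow> \<phi> differentiable (at x)"
  unfolding test_function_def by (meson Ck.simps(2))

lemma test_function_continuous: "test_function \<phi> \<Longrightarrow> continuous_on UNIV \<phi>"
  unfolding test_function_def using Ck_imp_continuous by blast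

lemma partial_locally_zero:
  fixes \<phi> :: "real^'n::finite \<Rightarrow> real"
  assumes "\<And>x. R < norm x \<Longrightarrow> \<phi> x = 0" "R < norm x"
  shows "partial i \<phi> x = 0"
proof -
  have "(\<phi> has_derivative (\<lambda>_. 0)) (at x)"
  proof (rule has_derivative_transform_within_open)
    show "((\<lambda>_. 0) has_derivative (\<lambda>_. 0)) (at x)" by (rule has_derivative_const)
    show "open {x::real^'n. R < norm x}" by (intro open_Collect_less continuous_intros)
  qed (use assms in auto)
  from partial_eq[OF this] show ?thesis .
qed

lemma test_function_partial:
  assumes "test_function \<phi>" shows "test_function (partial i \<phi>)"
proof -
  obtain R where "0 < R" "\<And>x. R < norm x \<Longrightarrow> \<phi> x = 0"
    using test_function_supported[OF assms] by blast
  moreover have "Ck k (partial i \<phi>)" for k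
    using assms unfolding test_function_def by (meson Ck.simps(2))
  ultimately show ?thesis
    using partial_locally_zero[of R \<phi>] by (intro test_functionI[where R = R]) auto
qed

lemma partial_translate:
  fixes \<phi> :: "real^'n::finite \<Rightarrow> real"
  assumes "\<phi> differentiable (at (y - x))"
  shows "partial i (\<lambda>y. \<phi> (y - x)) y = partial i \<phi> (y - x)"
    and "(\<lambda>y. \<phi> (y - x)) differentiable (at y)"
proof -
  have "((\<lambda>y. y - x) has_derivative (\<lambda>h. h)) (at y)" by (auto intro!: derivative_eq_intros)
  from has_derivative_compose[OF this has_derivative_grad[OF assms]]
  show "partial i (\<lambda>y. \<phi> (y - x)) y = partial i \<phi> (y - x)" "(\<lambda>y. \<phi> (y - x)) differentiable (at y)"
    by (auto simp: partial_eq grad_def inner_axis differentiable_def)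
qed

lemma Ck_translate: "(\<And>k. Ck k \<phi>) \<Longrightarrow> Ck k (\<lambda>y. \<phi> (y - x))"
proof (induction k arbitrary: \<phi>)
  case 0
  have "continuous_on UNIV \<phi>" using 0[of 0] by simp
  then show ?case
    by (simp add: continuous_on_compose2[of UNIV \<phi>] continuous_intros)
next
  case (Suc k)
  have d: "\<And>x. \<phi> differentiable (at x)" and p: "\<And>i k. Ck k (partial i \<phi>)"
    using Suc.prems by (meson Ck.simps(2))+
  have "partial i (\<lambda>y. \<phi> (y - x)) = (\<lambda>y. partial i \<phi> (y - x))" for i
    using partial_translate(1)[OF d] by blast
  with Suc.IH[OF p] partial_translate(2)[OF d] show ?case by simp
qed

lemma test_function_translate:
  assumes "test_function \<phi>" shows "test_function (\<lambda>y. \<phi> (y - x))"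
proof -
  obtain R where R: "0 < R" "\<And>x. R < norm x \<Longrightarrow> \<phi> x = 0"
    using test_function_supported[OF assms] by blast
  show ?thesis
  proof (rule test_functionI[where R = "R + norm x"])
    show "Ck k (\<lambda>y. \<phi> (y - x))" for k using assms by (simp add: Ck_translate test_function_def)
    show "\<phi> (y - x) = 0" if "R + norm x < norm y" for y
      using that norm_triangle_ineq2[of y x] by (intro R(2)) linarith
  qed
qed

text \<open>Evenness cancels first-order terms, so the error is quadratic in \<rho> and the centre
  of mass is the base point. The sup bound, with \<open>B\<close> independent of \<rho>, compares an
  average against the kernel with an average over a cube.\<close>

definition mollifier :: "real \<Rightarrow> real \<Rightarrow> (real^'n::finite \<Rightarrow> real) \<Rightarrow> bool" where
  "mollifier B \<rho> K \<longleftrightarrow> test_function K \<and> (\<forall>w. 0 \<le> K w \<and> K w \<le> B / \<rho> ^ CARD('n)) \<and>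
    (\<forall>w. K (- w) = K w) \<and> (\<forall>w. \<rho> < norm w \<longrightarrow> K w = 0) \<and> (LINT w|lborel. K w) = 1"

lemma lborel_integral_scale:
  fixes g :: "real^'n::finite \<Rightarrow> real"
  assumes "0 < \<rho>" "g \<in> borel_measurable borel"
  shows "(LINT w|lborel. g ((1 / \<rho>) *\<^sub>R w)) = \<rho> ^ CARD('n) * (LINT w|lborel. g w)"
proof -
  have "(LINT w|lborel. g ((1 / \<rho>) *\<^sub>R w)) =
    (LINT w|density (distr lborel borel (\<lambda>x::real^'n. 0 + \<rho> *\<^sub>R x)) (\<lambda>_. \<bar>\<rho>\<bar>^DIM(real^'n)). g ((1 / \<rho>) *\<^sub>R w))"
    using lborel_affine[of \<rho> "0::real^'n"] assms(1) by simp
  also have "\<dots> = (LINT w|distr lborel borel (\<lambda>x::real^'n. 0 + \<rho> *\<^sub>R x). \<rho> ^ CARD('n) * g ((1 / \<rho>) *\<^sub>R w))"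
    using assms by (subst integral_density) (auto simp: ennreal_power)
  also have "\<dots> = (LINT w|lborel. \<rho> ^ CARD('n) * g w)"
    using assms by (subst integral_distr) auto
  finally show ?thesis using assms by simp
qed

text \<open>Rescaling one bump of mass \<open>Z\<close> at unit scale gives all kernels; the common
  constant is \<open>1 / Z\<close>.\<close>

lemma mollifier_exists:
  obtains B where "\<And>\<rho>. 0 < \<rho> \<Longrightarrow> \<exists>K :: real^'n::finite \<Rightarrow> real. mollifier B \<rho> K"
proof -
  define g where "g x = flat_exp 0 (1 - x \<bullet> x)" for x :: "real^'n"
  have g_bump: "bump 1 g" using bump.flat[of 1 0] by (simp add: g_def[abs_def])
  have g_meas [measurable]: "g \<in> borel_measurable borel"
    using Ck_bump[OF g_bump, of 0] by (simp add: borel_measurable_continuous_onI)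
  have g_range: "0 \<le> g x \<and> g x \<le> 1" for x by (simp add: g_def flat_exp_def)
  have g_int: "integrable lborel g"
  proof (rule Bochner_Integration.integrable_bound)
    show "integrable lborel (indicator (cball 0 1) :: real^'n \<Rightarrow> real)"
      using emeasure_lborel_cball_finite[of "0::real^'n" 1] by (simp add: integrable_indicator_iff)
    show "AE x in lborel. norm (g x) \<le> norm (indicator (cball 0 1) x :: real)"
      using g_range bump_eq_0[OF g_bump] by (auto simp: indicator_def abs_of_nonneg not_le)
  qed simp
  define Z where "Z = (LINT w|lborel. g w)"
  \<comment> \<open>A nonnegative function of integral 0 vanishes almost everywhere, but
    \<open>g\<close> is positive on the open unit ball, which is not negligible.\<close>
  have "Z \<noteq> 0"
  proof
    assume "Z = 0"
    then have "AE x in lborel. g x = 0"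
      using g_int g_range by (simp add: Z_def integral_nonneg_eq_0_iff_AE)
    then have "AE x in lebesgue. x \<notin> ball (0::real^'n) 1"
      by (intro AE_completion) (auto elim!: eventually_mono simp: g_def flat_exp_def dot_square_norm
          power_less_one_iff abs_square_less_1)
    then have "negligible (ball (0::real^'n) 1)"
      using AE_iff_null_sets[of "ball (0::real^'n) 1" lebesgue] by (simp add: negligible_iff_null_sets)
    then show False using open_not_negligible[of "ball (0::real^'n) 1"] by simp
  qed
  moreover have "Z \<ge> 0" using g_range by (simp add: Z_def)
  ultimately have Z: "0 < Z" by simp
  have "\<exists>K :: real^'n \<Rightarrow> real. mollifier (1 / Z) \<rho> K" if \<rho>: "0 < \<rho>" for \<rho>
  proof -
    define K where "K x = 1 / (Z * \<rho> ^ CARD('n)) * flat_exp 0 (1 - x \<bullet> x / \<rho>\<^sup>2)" for x :: "real^'n"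
    have K: "bump \<rho> K" unfolding K_def by (intro bump.intros)
    have Kg: "K x = 1 / (Z * \<rho> ^ CARD('n)) * g ((1 / \<rho>) *\<^sub>R x)" for x
      by (simp add: K_def g_def power2_eq_square)
    have "(LINT w|lborel. K w) = 1"
      unfolding Kg using lborel_integral_scale[OF \<rho> g_meas] Z \<rho> by (simp add: Z_def)
    moreover have "test_function K"
      using Ck_bump[OF K] bump_eq_0[OF K \<rho>] by (intro test_functionI[where R = \<rho>]) auto
    moreover have "0 \<le> K w \<and> K w \<le> 1 / Z / \<rho> ^ CARD('n)" for w
      using Z \<rho> g_range[of "(1 / \<rho>) *\<^sub>R w"] by (simp add: Kg divide_right_mono)
    moreover have "K w = 0" if "\<rho> < norm w" for w
      using bump_eq_0[OF K \<rho>] that by simp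
    moreover have "K (- w) = K w" for w by (simp add: K_def)
    ultimately show ?thesis unfolding mollifier_def by blast
  qed
  then show thesis by (rule that)
qed

subsection \<open>Mollification\<close>

text \<open>With the argument \<open>y - x\<close> the kernel is a translate of a test function in
  the integration variable, as the weak Hessian requires. For even \<open>K\<close> this is the
  usual convolution; each derivative in \<open>x\<close> costs a sign.\<close>

definition mollify :: "(real^'n::finite \<Rightarrow> real) \<Rightarrow> (real^'n \<Rightarrow> real) \<Rightarrow> real^'n \<Rightarrow> real" where
  "mollify K u x = (LINT y|lborel. K (y - x) * u y)"

lemma integrable_continuous_compact_support:
  fixes g :: "'a::euclidean_space \<Rightarrow> real"
  assumes "continuous_on UNIV g" "\<And>x. R < norm x \<Longrightarrow> g x = 0"
  shows "integrable lborel g"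
proof -
  have "integrable lborel (\<lambda>x. indicator (cball 0 R) x *\<^sub>R g x)"
    using assms(1) by (intro borel_integrable_compact) (auto intro: continuous_on_subset)
  moreover have "(\<lambda>x. indicator (cball 0 R) x *\<^sub>R g x) = g"
    using assms(2) by (auto simp: indicator_def fun_eq_iff not_le)
  ultimately show ?thesis by simp
qed

lemma integrable_mollify:
  fixes K :: "real^'n::finite \<Rightarrow> real"
  assumes "test_function K" "continuous_on UNIV u"
  shows "integrable lborel (\<lambda>y. K (y - x) * u y)"
proof -
  obtain R where R: "0 < R" "\<And>y. R < norm y \<Longrightarrow> K (y - x) = 0"
    using test_function_supported[OF test_function_translate[OF assms(1), of x]] by blast
  show ?thesis
    using test_function_continuous[OF test_function_translate[OF assms(1)]] assms(2)
    by (intro integrable_continuous_compact_support[where R = R] continuous_intros) (auto simp: R)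
qed

lemma mollify_has_derivative:
  fixes K :: "real^'n::finite \<Rightarrow> real"
  assumes K: "test_function K" and u: "continuous_on UNIV u"
  shows "partial i (mollify K u) x0 = - mollify (partial i K) u x0"
    and "mollify K u differentiable (at x0)"
proof -
  obtain R where R: "0 < R" "\<And>y. R < norm y \<Longrightarrow> K y = 0"
    using test_function_supported[OF K] by blast
  \<comment> \<open>For \<open>x\<close> within distance 1 of \<open>x0\<close> all kernels vanish
    outside this fixed box, which brings the integral into the scope of the Leibniz rule.\<close>
  obtain a where a: "cball x0 (R + 1) \<subseteq> cbox (- a) a"
    using bounded_subset_cbox_symmetric[of "cball x0 (R + 1)"] by auto
  define U where "U = ball x0 1"
  have out: "t - x \<in> {y. R < norm y}" if "x \<in> U" "t \<notin> cbox (- a) a" for x t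
  proof -
    have "R + 1 < dist x0 t" using that(2) a by (force simp: not_le[symmetric])
    with that(1) show ?thesis
      using dist_triangle[of x0 t x] by (auto simp: U_def dist_norm norm_minus_commute)
  qed
  have mol: "mollify k u x = integral (cbox (- a) a) (\<lambda>t. k (t - x) * u t)"
    if "test_function k" "\<And>y. R < norm y \<Longrightarrow> k y = 0" "x \<in> U" for k x
  proof -
    have "mollify k u x = integral UNIV (\<lambda>t. k (t - x) * u t)"
      unfolding mollify_def by (rule integral_lborel[symmetric, OF integrable_mollify[OF that(1) u]])
    also have "(\<lambda>t. k (t - x) * u t) = (\<lambda>t. if t \<in> cbox (- a) a then k (t - x) * u t else 0)"
      using out that by (auto simp: fun_eq_iff)
    finally show ?thesis by (simp add: integral_restrict_UNIV)
  qed
  \<comment> \<open>The derivative of the integrand in \<open>x\<close>, as a bounded linear map;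
    the minus sign comes from differentiating \<open>t - x\<close>.\<close>
  define fx where "fx x t = blinfun_inner_right (- u t *\<^sub>R grad K (t - x))" for x t
  have cK: "continuous_on UNIV (\<lambda>x. grad K x)"
    unfolding grad_def
    by (intro continuous_on_vec_lambda test_function_continuous test_function_partial K)
  have der: "((\<lambda>x. integral (cbox (- a) a) (\<lambda>t. K (t - x) * u t)) has_derivative
      integral (cbox (- a) a) (fx x0)) (at x0 within U)"
  proof (rule leibniz_rule)
    show "((\<lambda>x. K (t - x) * u t) has_derivative blinfun_apply (fx x t)) (at x within U)" for x t
    proof -
      have "((\<lambda>x. t - x) has_derivative (\<lambda>h. - h)) (at x within U)"
        by (auto intro!: derivative_eq_intros)
      from has_derivative_compose[OF this has_derivative_grad[OF test_function_differentiable[OF K]]]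
      have "((\<lambda>x. K (t - x)) has_derivative (\<lambda>h. grad K (t - x) \<bullet> - h)) (at x within U)" .
      from has_derivative_mult_left[OF this, of "u t"]
      have "((\<lambda>x. K (t - x) * u t) has_derivative (\<lambda>h. (grad K (t - x) \<bullet> - h) * u t)) (at x within U)" .
      moreover have "blinfun_apply (fx x t) = (\<lambda>h. (grad K (t - x) \<bullet> - h) * u t)"
        by (simp add: fx_def fun_eq_iff)
      ultimately show ?thesis by simp
    qed
    show "(\<lambda>t. K (t - x) * u t) integrable_on cbox (- a) a" for x
      using test_function_continuous[OF test_function_translate[OF K]] u
      by (intro integrable_continuous continuous_intros) (auto intro: continuous_on_subset)
    have "continuous_on UNIV (\<lambda>z::(real^'n)\<times>(real^'n). grad K (snd z - fst z))"
      by (rule continuous_on_compose2[OF cK]) (auto intro!: continuous_intros)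
    moreover have "continuous_on UNIV (\<lambda>z::(real^'n)\<times>(real^'n). u (snd z))"
      by (rule continuous_on_compose2[OF u]) (auto intro!: continuous_intros)
    ultimately have "continuous_on UNIV (\<lambda>z::(real^'n)\<times>(real^'n). fx (fst z) (snd z))"
      unfolding fx_def
      by (intro bounded_linear.continuous_on[OF bounded_linear_blinfun_inner_right] continuous_intros)
    then show "continuous_on (U \<times> cbox (- a) a) (\<lambda>(x, t). fx x t)"
      unfolding case_prod_beta by (rule continuous_on_subset) simp
    show "x0 \<in> U" "convex U" by (simp_all add: U_def)
  qed
  have der': "(mollify K u has_derivative integral (cbox (- a) a) (fx x0)) (at x0)"
  proof (rule has_derivative_transform_within_open)
    have "at x0 within U = at x0" by (rule at_within_open) (simp_all add: U_def)
    then show "((\<lambda>x. integral (cbox (- a) a) (\<lambda>t. K (t - x) * u t)) has_derivative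
        integral (cbox (- a) a) (fx x0)) (at x0)"
      using der by (simp only:)
    show "open U" "x0 \<in> U" by (simp_all add: U_def)
    show "integral (cbox (- a) a) (\<lambda>t. K (t - x) * u t) = mollify K u x" if "x \<in> U" for x
      using mol[OF K R(2) that] by simp
  qed
  then show "mollify K u differentiable (at x0)" by (auto simp: differentiable_def)
  have "continuous_on UNIV (\<lambda>t. fx x0 t)"
    unfolding fx_def
    by (intro bounded_linear.continuous_on[OF bounded_linear_blinfun_inner_right] continuous_intros u
        continuous_on_compose2[OF cK]) auto
  then have int: "fx x0 integrable_on cbox (- a) a"
    by (intro integrable_continuous) (auto intro: continuous_on_subset)
  have "partial i (mollify K u) x0 = integral (cbox (- a) a) (\<lambda>t. fx x0 t (axis i 1))"
    using integral_linear[OF int blinfun.bounded_linear_left[of "axis i 1"]]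
    by (simp add: partial_eq[OF der'] o_def)
  also have "\<dots> = integral (cbox (- a) a) (\<lambda>t. - (partial i K (t - x0) * u t))"
    by (simp add: fx_def inner_axis grad_def mult.commute)
  also have "\<dots> = - mollify (partial i K) u x0"
  proof -
    have "x0 \<in> U" by (simp add: U_def)
    moreover have "partial i K y = 0" if "R < norm y" for y
      using partial_locally_zero[of R K y i] R(2) that by blast
    ultimately show ?thesis using mol[OF test_function_partial[OF K], of i x0] by simp
  qed
  finally show "partial i (mollify K u) x0 = - mollify (partial i K) u x0" .
qed

lemma Ck_mollify:
  assumes "test_function K" "continuous_on UNIV u" shows "Ck k (mollify K u)"
  using assms
proof (induction k arbitrary: K)
  case 0
  then show ?case
    by (auto intro!: differentiable_imp_continuous_on
        simp: differentiable_on_def mollify_has_derivative(2) differentiable_at_withinI)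
next
  case (Suc k)
  have "partial i (mollify K u) = (\<lambda>x. (- 1) * mollify (partial i K) u x)" for i
    using mollify_has_derivative(1)[OF Suc.prems] by auto
  moreover have "Ck k (\<lambda>x. (- 1) * mollify (partial i K) u x)" for i
    by (intro Ck_cmult Suc test_function_partial)
  ultimately show ?case using mollify_has_derivative(2)[OF Suc.prems] by simp
qed

lemma partial_partial_mollify:
  assumes "test_function K" "continuous_on UNIV u"
  shows "partial i (partial j (mollify K u)) x = mollify (partial i (partial j K)) u x"
proof -
  have "partial j (mollify K u) = (\<lambda>x. (- 1) * mollify (partial j K) u x)"
    using mollify_has_derivative(1)[OF assms] by auto
  then show ?thesis
    using mollify_has_derivative[OF test_function_partial[OF assms(1), of j] assms(2)]
    by (simp only: partial_cmult)
qed

lemma hessian_translate: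
  assumes "test_function K"
  shows "hessian (\<lambda>y. K (y - x)) y = hessian K (y - x)"
proof -
  have "partial j (\<lambda>y. K (y - x)) = (\<lambda>y. partial j K (y - x))" for j
    using partial_translate(1)[OF test_function_differentiable[OF assms]] by blast
  then show ?thesis
    by (simp add: hessian_def vec_eq_iff partial_translate test_function_differentiable
        test_function_partial assms)
qed

text \<open>The norm on matrices is the Euclidean norm of all entries (Frobenius norm);
  Cauchy-Schwarz in each row shows that it dominates the operator norm.\<close>

lemma abs_inner_matrix_le:
  fixes M :: "real^'n^'n"
  shows "\<bar>v \<bullet> (M *v w)\<bar> \<le> norm M * norm v * norm w" "norm (M *v w) \<le> norm M * norm w"
proof -
  show n: "norm (M *v w) \<le> norm M * norm w"
  proof (rule power2_le_imp_le)
    have "(norm (M *v w))\<^sup>2 = (\<Sum>i\<in>UNIV. (M $ i \<bullet> w)\<^sup>2)"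
      unfolding power2_norm_eq_inner inner_vec_def[of "M *v w"] matrix_vector_mul_component
      by (simp add: power2_eq_square)
    also have "\<dots> \<le> (\<Sum>i\<in>UNIV. (norm (M $ i))\<^sup>2 * (norm w)\<^sup>2)"
      by (intro sum_mono) (metis Cauchy_Schwarz_ineq power2_norm_eq_inner)
    also have "\<dots> = (norm M * norm w)\<^sup>2"
      unfolding power_mult_distrib power2_norm_eq_inner inner_vec_def[of M]
      by (simp add: sum_distrib_right)
    finally show "(norm (M *v w))\<^sup>2 \<le> (norm M * norm w)\<^sup>2" .
  qed simp
  have "\<bar>v \<bullet> (M *v w)\<bar> \<le> norm v * norm (M *v w)" by (rule Cauchy_Schwarz_ineq2)
  also have "\<dots> \<le> norm v * (norm M * norm w)" using n by (intro mult_left_mono) auto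
  finally show "\<bar>v \<bullet> (M *v w)\<bar> \<le> norm M * norm v * norm w" by (simp add: ac_simps)
qed

lemma lborel_integral_unit_affine:
  fixes g :: "'a::euclidean_space \<Rightarrow> 'b::{banach, second_countable_topology}"
  assumes [measurable]: "g \<in> borel_measurable borel" and c: "\<bar>c\<bar> = 1"
  shows "(LINT y|lborel. g (t + c *\<^sub>R y)) = (LINT y|lborel. g y)"
proof -
  have "c \<noteq> 0" using c by auto
  then have "(LINT y|lborel. g y) =
    (LINT y|density (distr lborel borel (\<lambda>x. t + c *\<^sub>R x)) (\<lambda>_. \<bar>c\<bar>^DIM('a)). g y)"
    using lborel_affine[of c t] by simp
  also have "\<dots> = (LINT y|distr lborel borel (\<lambda>x. t + c *\<^sub>R x). g y)"
    by (simp add: c density_1)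
  also have "\<dots> = (LINT y|lborel. g (t + c *\<^sub>R y))"
    by (simp add: integral_distr)
  finally show ?thesis by simp
qed

section \<open>Error estimates for even kernels\<close>

lemma mollifierD:
  fixes K :: "real^'n::finite \<Rightarrow> real"
  assumes "mollifier B \<rho> K"
  shows "test_function K" "0 \<le> K w" "K w \<le> B / \<rho> ^ CARD('n)" "K (- w) = K w"
    "\<rho> < norm w \<Longrightarrow> K w = 0" "(LINT w|lborel. K w) = 1"
  using assms by (auto simp: mollifier_def)

lemma mollifier_translate:
  assumes "mollifier B \<rho> K"
  shows "integrable lborel (\<lambda>y. K (y - x))" "(LINT y|lborel. K (y - x)) = 1"
proof -
  note K = mollifierD[OF assms]
  show "integrable lborel (\<lambda>y. K (y - x))"
    using integrable_mollify[OF K(1), of "\<lambda>_. 1" x] by simp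
  have "K \<in> borel_measurable borel"
    using test_function_continuous[OF K(1)] by (rule borel_measurable_continuous_onI)
  from lborel_integral_unit_affine[OF this, of 1 "- x"] show "(LINT y|lborel. K (y - x)) = 1"
    by (simp add: K(6))
qed

lemma mollify_symmetric:
  fixes u :: "real^'n::finite \<Rightarrow> real"
  assumes K: "mollifier B \<rho> K" and u: "continuous_on UNIV u" and c: "\<bar>c\<bar> = 1"
  shows "mollify K u x = (LINT w|lborel. K w * u (x + c *\<^sub>R w))"
    and "integrable lborel (\<lambda>w. K w * u (x + c *\<^sub>R w))"
proof -
  note KD = mollifierD[OF K]
  have "c = 1 \<or> c = -1" using c by auto
  then have Kc: "K (c *\<^sub>R w) = K w" for w using KD(4) by auto
  have [measurable]: "(\<lambda>y. K (y - x) * u y) \<in> borel_measurable borel"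
    using test_function_continuous[OF test_function_translate[OF KD(1)]] u
    by (intro borel_measurable_continuous_onI continuous_intros)
  show "mollify K u x = (LINT w|lborel. K w * u (x + c *\<^sub>R w))"
    unfolding mollify_def
    using lborel_integral_unit_affine[of "\<lambda>y. K (y - x) * u y" c x] c by (simp add: Kc)
  have "continuous_on UNIV (\<lambda>w. u (x + c *\<^sub>R w))"
    by (rule continuous_on_compose2[OF u]) (auto intro!: continuous_intros)
  from integrable_mollify[OF KD(1) this, of 0]
  show "integrable lborel (\<lambda>w. K w * u (x + c *\<^sub>R w))" by simp
qed

lemma mollify_diff_le:
  assumes K: "mollifier B \<rho> K" and u: "continuous_on UNIV u"
    and e: "\<And>w. norm w \<le> \<rho> \<Longrightarrow> \<bar>u (x + w) - u x\<bar> \<le> e"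
  shows "\<bar>mollify K u x - u x\<bar> \<le> e"
proof -
  note KD = mollifierD[OF K]
  note int = mollify_symmetric(2)[OF K u, of 1 x, simplified] mollifier_translate(1)[OF K, of 0, simplified]
  have "mollify K u x - u x = (LINT w|lborel. K w * u (x + w) - K w * u x)"
    using int by (simp add: mollify_symmetric(1)[OF K u, of 1] KD(6))
  also have "\<bar>\<dots>\<bar> \<le> (LINT w|lborel. K w * e)"
    unfolding real_norm_def[symmetric]
  proof (rule Bochner_Integration.integral_norm_bound_integral)
    show "norm (K w * u (x + w) - K w * u x) \<le> K w * e" for w
    proof (cases "norm w \<le> \<rho>")
      case True
      then have "K w * \<bar>u (x + w) - u x\<bar> \<le> K w * e" using e KD(2) by (intro mult_left_mono)
      then show ?thesis using KD(2)[of w] by (simp add: abs_mult flip: right_diff_distrib)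
    qed (use KD(5) in simp)
  qed (use int in auto)
  also have "\<dots> = e" by (simp add: KD(6))
  finally show ?thesis .
qed

text \<open>Adding the representations with \<open>w\<close> and \<open>- w\<close> turns twice the
  error into an average of symmetric second differences, so no derivative of \<open>u\<close>
  appears.\<close>

lemma mollify_error_second_difference:
  fixes u :: "real^'n::finite \<Rightarrow> real"
  assumes K: "mollifier B \<rho> K" and u: "continuous_on UNIV u" and C: "0 \<le> C"
    and diff: "\<And>h. \<bar>u (x + h) + u (x - h) - 2 * u x\<bar> \<le> C * (norm h)\<^sup>2"
  shows "\<bar>mollify K u x - u x\<bar> \<le> C * \<rho>\<^sup>2 / 2"
proof -
  note KD = mollifierD[OF K]
  note i1 = mollify_symmetric(2)[OF K u, of 1 x, simplified]
    and i2 = mollify_symmetric(2)[OF K u, of "-1" x, simplified]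
    and i0 = mollifier_translate(1)[OF K, of 0, simplified]
  have "2 * (mollify K u x - u x) =
      (LINT w|lborel. K w * u (x + w)) + (LINT w|lborel. K w * u (x - w)) - (LINT w|lborel. K w * (2 * u x))"
    using mollify_symmetric(1)[OF K u, of 1 x] mollify_symmetric(1)[OF K u, of "-1" x]
    by (simp add: KD(6))
  also have "\<dots> = (LINT w|lborel. K w * u (x + w) + K w * u (x - w) - K w * (2 * u x))"
    using i0 i1 i2 by simp
  also have "\<bar>\<dots>\<bar> \<le> (LINT w|lborel. K w * (C * \<rho>\<^sup>2))"
    unfolding real_norm_def[symmetric]
  proof (rule Bochner_Integration.integral_norm_bound_integral)
    show "norm (K w * u (x + w) + K w * u (x - w) - K w * (2 * u x)) \<le> K w * (C * \<rho>\<^sup>2)" for w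
    proof (cases "norm w \<le> \<rho>")
      case True
      then have "C * (norm w)\<^sup>2 \<le> C * \<rho>\<^sup>2" using C by (intro mult_left_mono power_mono) auto
      then have "K w * \<bar>u (x + w) + u (x - w) - 2 * u x\<bar> \<le> K w * (C * \<rho>\<^sup>2)"
        using diff[of w] KD(2) by (intro mult_left_mono) auto
      then show ?thesis using KD(2)[of w]
        by (simp add: abs_mult flip: right_diff_distrib distrib_left)
    qed (use KD(5) in simp)
  qed (use i0 i1 i2 in auto)
  also have "\<dots> = C * \<rho>\<^sup>2" by (simp add: KD(6))
  finally show ?thesis unfolding abs_le_iff by (auto simp: field_simps)
qed

subsection \<open>Functions with bounded weak Hessian\<close>

text \<open>The representative \<open>A\<close> of the weak Hessian is bounded and symmetric at
  every point, not just almost everywhere, and the kernel constant \<open>B\<close> is fixed once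
  for all scales.\<close>

locale bounded_hessian =
  fixes u :: "real^'n::finite \<Rightarrow> real" and A :: "real^'n \<Rightarrow> real^'n^'n" and C B :: real
  assumes continuous_u: "continuous_on UNIV u"
    and A_measurable [measurable]: "A \<in> borel_measurable borel"
    and A_sym: "\<And>x. sym_mat (A x)"
    and A_bound: "\<And>x. norm (A x) \<le> C"
    and weak_hessian: "\<And>\<phi> i j. test_function \<phi> \<Longrightarrow>
      (LINT x|lborel. u x * hessian \<phi> x $ i $ j) = (LINT x|lborel. A x $ i $ j * \<phi> x)"
    and mollifiers: "\<And>\<rho>. 0 < \<rho> \<Longrightarrow> \<exists>K :: real^'n \<Rightarrow> real. mollifier B \<rho> K"
begin

lemma C_nonneg: "0 \<le> C"
  using A_bound[of 0] norm_ge_zero order_trans by blast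

lemma B_nonneg: "0 \<le> B"
proof -
  obtain K :: "real^'n \<Rightarrow> real" where K: "mollifier B 1 K" using mollifiers[of 1] by auto
  show ?thesis using mollifierD(2,3)[OF K, of 0] by simp
qed

lemma integrable_mollify_A:
  assumes "mollifier B' \<rho> K" shows "integrable lborel (\<lambda>y. K (y - x) *\<^sub>R A y)"
proof (rule Bochner_Integration.integrable_bound)
  note K = mollifierD[OF assms]
  show "integrable lborel (\<lambda>y. K (y - x) * C)"
    using mollifier_translate(1)[OF assms] by simp
  have [measurable]: "(\<lambda>y. K (y - x)) \<in> borel_measurable borel"
    using test_function_continuous[OF test_function_translate[OF K(1)]]
    by (rule borel_measurable_continuous_onI)
  show "(\<lambda>y. K (y - x) *\<^sub>R A y) \<in> borel_measurable lborel" by simp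
  show "AE y in lborel. norm (K (y - x) *\<^sub>R A y) \<le> norm (K (y - x) * C)"
    using A_bound K(2) C_nonneg by (auto simp: abs_mult intro!: mult_left_mono AE_I2)
qed

text \<open>Both derivatives fall on the translated kernel, which serves as the test function in the
  definition of the weak Hessian.\<close>

lemma hessian_mollify:
  assumes "mollifier B' \<rho> K"
  shows "hessian (mollify K u) x = (LINT y|lborel. K (y - x) *\<^sub>R A y)"
proof -
  note K = mollifierD(1)[OF assms]
  have "hessian (mollify K u) x $ i $ j = (LINT y|lborel. K (y - x) *\<^sub>R A y) $ i $ j" for i j
  proof -
    have "hessian (mollify K u) x $ i $ j = (LINT y|lborel. u y * hessian (\<lambda>y. K (y - x)) y $ i $ j)"
      by (simp add: hessian_def partial_partial_mollify[OF K continuous_u] hessian_translate[OF K, unfolded hessian_def]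
          mollify_def mult.commute)
    also have "\<dots> = (LINT y|lborel. (K (y - x) *\<^sub>R A y) $ i $ j)"
      by (simp add: weak_hessian[OF test_function_translate[OF K]] mult.commute)
    also have "\<dots> = (LINT y|lborel. K (y - x) *\<^sub>R A y) $ i $ j"
    proof -
      have "bounded_linear (\<lambda>M::real^'n^'n. M $ i $ j)"
        by (intro bounded_linear_compose[OF bounded_linear_vec_nth] bounded_linear_vec_nth)
      from integral_bounded_linear[OF this integrable_mollify_A[OF assms]] show ?thesis .
    qed
    finally show ?thesis .
  qed
  then show ?thesis by (simp add: vec_eq_iff)
qed

lemma norm_hessian_mollify_diff_le:
  assumes K: "mollifier B' \<rho> K" and M: "\<And>y. norm (y - x) \<le> \<rho> \<Longrightarrow> norm (A y - M) \<le> C'"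
  shows "norm (hessian (mollify K u) x - M) \<le> C'"
proof -
  note KD = mollifierD[OF K]
  note int = integrable_mollify_A[OF K, of x] mollifier_translate(1)[OF K, of x]
  have "hessian (mollify K u) x - M = (LINT y|lborel. K (y - x) *\<^sub>R A y - K (y - x) *\<^sub>R M)"
    using int by (simp add: hessian_mollify[OF K] mollifier_translate(2)[OF K])
  also have "norm \<dots> \<le> (LINT y|lborel. K (y - x) * C')"
  proof (rule Bochner_Integration.integral_norm_bound_integral)
    show "norm (K (y - x) *\<^sub>R A y - K (y - x) *\<^sub>R M) \<le> K (y - x) * C'" for y
    proof (cases "norm (y - x) \<le> \<rho>")
      case True
      then have "K (y - x) * norm (A y - M) \<le> K (y - x) * C'" using M KD(2) by (intro mult_left_mono)
      then show ?thesis using KD(2)[of "y - x"] by (simp flip: scaleR_right_diff_distrib)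
    qed (use KD(5) in simp)
  qed (use int in auto)
  also have "\<dots> = C'" by (simp add: mollifier_translate(2)[OF K])
  finally show ?thesis .
qed

lemma norm_hessian_mollify_le:
  "mollifier B' \<rho> K \<Longrightarrow> norm (hessian (mollify K u) x) \<le> C"
  using norm_hessian_mollify_diff_le[of B' \<rho> K x 0 C] A_bound by simp

lemma C2_mollify: "mollifier B' \<rho> K \<Longrightarrow> C2 (mollify K u)"
  using Ck_mollify[OF mollifierD(1) continuous_u] .

lemma mollify_Taylor_le:
  assumes "mollifier B' \<rho> K"
  shows "\<bar>mollify K u (x + h) - mollify K u x - grad (mollify K u) x \<bullet> h\<bar> \<le> C * (norm h)\<^sup>2 / 2"
proof -
  obtain t where t: "mollify K u (x + h) = mollify K u x + grad (mollify K u) x \<bullet> h +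
      h \<bullet> (hessian (mollify K u) (x + t *\<^sub>R h) *v h) / 2"
    using Taylor2[OF C2_mollify[OF assms]] by metis
  have "\<bar>h \<bullet> (hessian (mollify K u) (x + t *\<^sub>R h) *v h)\<bar> \<le>
      norm (hessian (mollify K u) (x + t *\<^sub>R h)) * norm h * norm h" by (rule abs_inner_matrix_le)
  also have "\<dots> \<le> C * norm h * norm h"
    using norm_hessian_mollify_le[OF assms] by (intro mult_right_mono) auto
  finally show ?thesis using t by (simp add: power2_eq_square)
qed

lemma grad_mollify_Lipschitz:
  assumes "mollifier B' \<rho> K"
  shows "norm (grad (mollify K u) y - grad (mollify K u) x) \<le> C * norm (y - x)"
proof -
  let ?g = "grad (mollify K u) y - grad (mollify K u) x"
  \<comment> \<open>Pairing the gradient increment with itself produces its squared norm; one factor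
    cancels at the end.\<close>
  obtain t where t: "?g \<bullet> ?g = (y - x) \<bullet> (hessian (mollify K u) (x + t *\<^sub>R (y - x)) *v ?g)"
    using grad_mean_value[OF C2_mollify[OF assms], of x "y - x" ?g] by auto
  have "(norm ?g)\<^sup>2 \<le> norm (hessian (mollify K u) (x + t *\<^sub>R (y - x))) * norm (y - x) * norm ?g"
    unfolding power2_norm_eq_inner t using abs_inner_matrix_le(1) abs_le_iff by blast
  also have "\<dots> \<le> C * norm (y - x) * norm ?g"
    using norm_hessian_mollify_le[OF assms] by (intro mult_right_mono) auto
  finally have "norm ?g * norm ?g \<le> (C * norm (y - x)) * norm ?g" by (simp add: power2_eq_square)
  then show ?thesis using C_nonneg by (cases "norm ?g = 0") auto
qed

text \<open>Taylor's formula at \<open>h\<close> and \<open>- h\<close> gives the bound for every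
  mollification, since the gradient terms cancel. With three points fixed, continuity alone makes
  the mollification error small: the budget is \<open>e / 4\<close> at each outer point and twice
  that at \<open>x\<close>.\<close>

lemma second_difference_le:
  "\<bar>u (x + h) + u (x - h) - 2 * u x\<bar> \<le> C * (norm h)\<^sup>2"
proof (rule field_le_epsilon)
  fix e :: real assume "0 < e"
  then have "0 < e / 4" by simp
  have "\<exists>d>0. \<forall>w. norm w \<le> d \<longrightarrow> \<bar>u (z + w) - u z\<bar> \<le> e / 4" for z
  proof -
    obtain d where d: "d > 0" "\<And>z'. dist z' z < d \<Longrightarrow> dist (u z') (u z) < e / 4"
      using continuous_u \<open>0 < e / 4\<close> unfolding continuous_on_iff by blast
    have "\<bar>u (z + w) - u z\<bar> \<le> e / 4" if "norm w \<le> d / 2" for w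
      using d(2)[of "z + w"] d(1) that by (simp add: dist_norm)
    with d(1) show ?thesis by (intro exI[of _ "d / 2"]) auto
  qed
  then obtain d where d: "\<And>z. d z > 0" "\<And>z w. norm w \<le> d z \<Longrightarrow> \<bar>u (z + w) - u z\<bar> \<le> e / 4"
    by metis
  define \<rho> where "\<rho> = min (d x) (min (d (x + h)) (d (x - h)))"
  have "0 < \<rho>" using d(1) by (simp add: \<rho>_def)
  then obtain K :: "real^'n \<Rightarrow> real" where K: "mollifier B \<rho> K" using mollifiers by blast
  have near: "\<bar>mollify K u z - u z\<bar> \<le> e / 4" if "\<rho> \<le> d z" for z
    by (rule mollify_diff_le[OF K continuous_u]) (rule d(2), use that in linarith)
  have 1: "\<bar>mollify K u x - u x\<bar> \<le> e / 4" "\<bar>mollify K u (x + h) - u (x + h)\<bar> \<le> e / 4"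
    "\<bar>mollify K u (x - h) - u (x - h)\<bar> \<le> e / 4"
    by (rule near; simp add: \<rho>_def)+
  have 2: "\<bar>mollify K u (x + h) - mollify K u x - grad (mollify K u) x \<bullet> h\<bar> \<le> C * (norm h)\<^sup>2 / 2"
    "\<bar>mollify K u (x - h) - mollify K u x + grad (mollify K u) x \<bullet> h\<bar> \<le> C * (norm h)\<^sup>2 / 2"
    using mollify_Taylor_le[OF K, of x h] mollify_Taylor_le[OF K, of x "- h"] by simp_all
  from 1 2 show "\<bar>u (x + h) + u (x - h) - 2 * u x\<bar> \<le> C * (norm h)\<^sup>2 + e"
    unfolding abs_le_iff by linarith
qed

text \<open>The bound on second differences upgrades pointwise convergence to a rate that is uniform
  in \<open>x\<close>.\<close>

lemma mollify_error:
  "mollifier B' \<rho> K \<Longrightarrow> \<bar>mollify K u x - u x\<bar> \<le> C * \<rho>\<^sup>2 / 2"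
  by (rule mollify_error_second_difference[OF _ continuous_u C_nonneg second_difference_le])

text \<open>Interpolation: both mollifications are within \<open>C \<epsilon>\<^sup>2\<close> of each other and have second
  derivatives bounded by \<open>C\<close>, so a step of length \<open>\<epsilon>\<close> controls the difference of the gradients.\<close>

lemma grad_mollify_diff_le:
  assumes K: "mollifier B' \<rho> K" and K': "mollifier B'' \<epsilon> K'" and \<rho>: "0 < \<rho>" "\<rho> \<le> \<epsilon>"
  shows "norm (grad (mollify K u) x - grad (mollify K' u) x) \<le> 3 * C * \<epsilon>"
proof -
  let ?g = "grad (mollify K u) x - grad (mollify K' u) x"
  define h where "h = (\<epsilon> / norm ?g) *\<^sub>R ?g"
  show ?thesis
  proof (cases "?g = 0")
    case False
    have nh: "norm h = \<epsilon>" using False \<rho> by (simp add: h_def)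
    have gh: "?g \<bullet> h = \<epsilon> * norm ?g"
      using False by (simp add: h_def dot_square_norm power2_eq_square)
    have "C * \<rho>\<^sup>2 / 2 \<le> C * \<epsilon>\<^sup>2 / 2"
      using \<rho> C_nonneg by (intro divide_right_mono mult_left_mono power_mono) auto
    then have 1: "\<bar>mollify K u y - mollify K' u y\<bar> \<le> C * \<epsilon>\<^sup>2" for y
      using mollify_error[OF K, of y] mollify_error[OF K', of y] by linarith
    \<comment> \<open>The 3 collects 1 from each difference of values, at \<open>x\<close> and at
      \<open>x + h\<close>, and 1/2 from each Taylor remainder.\<close>
    have "?g \<bullet> h \<le> 3 * C * \<epsilon>\<^sup>2"
      using 1[of x] 1[of "x + h"] mollify_Taylor_le[OF K, of x h] mollify_Taylor_le[OF K', of x h]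
      unfolding nh inner_diff_left by linarith
    then have "\<epsilon> * norm ?g \<le> \<epsilon> * (3 * C * \<epsilon>)" unfolding gh by (simp add: power2_eq_square algebra_simps)
    then show ?thesis using \<rho> by simp
  qed (use \<rho> C_nonneg in simp)
qed

text \<open>Lebesgue differentiation is applied to the scalar functions
  \<open>norm (A y - q)\<close> with \<open>q\<close> in a countable dense set of matrices; the
  value \<open>A y0\<close> is then approximated by such a \<open>q\<close>. The cubes have
  \<open>y0\<close> as a corner, as the differentiation theorem supplies them.\<close>

lemma ae_Lebesgue_point:
  "AE y0 in lborel. \<forall>e>0. \<exists>d>0. \<forall>h. 0 < h \<and> h < d \<longrightarrow>
    (LINT y|lborel. indicator (cbox y0 (y0 + h *\<^sub>R One)) y * norm (A y - A y0)) \<le> e * h ^ CARD('n)"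
proof -
  obtain D :: "(real^'n^'n) set" where D: "countable D" "\<And>X. open X \<Longrightarrow> X \<noteq> {} \<Longrightarrow> \<exists>d\<in>D. d \<in> X"
    by (erule countable_dense_setE)
  have sint: "set_integrable lborel (cbox a b) (\<lambda>y. norm (A y - q))" for a b q
    unfolding set_integrable_def
  proof (rule Bochner_Integration.integrable_bound)
    show "integrable lborel (\<lambda>y. indicator (cbox a b) y *\<^sub>R (C + norm q))"
      using emeasure_lborel_cbox_finite[of a b] by (intro integrable_indicator) simp_all
    show "AE y in lborel. norm (indicator (cbox a b) y *\<^sub>R norm (A y - q)) \<le>
        norm (indicator (cbox a b) y *\<^sub>R (C + norm q))"
    proof (intro AE_I2)
      fix y
      have "norm (A y - q) \<le> C + norm q" using A_bound[of y] norm_triangle_ineq4[of "A y" q] by linarith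
      then show "norm (indicator (cbox a b) y *\<^sub>R norm (A y - q)) \<le>
        norm (indicator (cbox a b) y *\<^sub>R (C + norm q))"
        using C_nonneg by (auto simp: indicator_def)
    qed
  qed simp
  have "AE y0 in lborel. \<forall>e>0. \<exists>d>0. \<forall>h. 0 < h \<and> h < d \<longrightarrow>
      norm (integral (cbox y0 (y0 + h *\<^sub>R One)) (\<lambda>y. norm (A y - q)) /\<^sub>R h ^ DIM(real^'n) - norm (A y0 - q)) < e" for q
  proof -
    have "(\<lambda>y. norm (A y - q)) integrable_on cbox a b" for a b
      using set_borel_integral_eq_integral(1)[OF sint] .
    then obtain N where N: "negligible N" "\<And>x e. \<lbrakk>x \<notin> N; 0 < e\<rbrakk> \<Longrightarrow> \<exists>d>0. \<forall>h. 0 < h \<and> h < d \<longrightarrow>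
        norm (integral (cbox x (x + h *\<^sub>R One)) (\<lambda>y. norm (A y - q)) /\<^sub>R h ^ DIM(real^'n) - norm (A x - q)) < e"
      using integrable_ccontinuous_explicit[of "\<lambda>y. norm (A y - q)"] by blast
    \<comment> \<open>The exceptional set is Lebesgue null but perhaps not Borel, hence the passage
      through the completion.\<close>
    have "AE y0 in lebesgue. y0 \<notin> N"
      using N(1) by (auto simp: negligible_iff_null_sets intro: AE_not_in)
    then show ?thesis
      by (subst AE_completion_iff[symmetric], elim eventually_mono) (use N(2) in blast)
  qed
  then have "AE y0 in lborel. \<forall>q\<in>D. \<forall>e>0. \<exists>d>0. \<forall>h. 0 < h \<and> h < d \<longrightarrow>
      norm (integral (cbox y0 (y0 + h *\<^sub>R One)) (\<lambda>y. norm (A y - q)) /\<^sub>R h ^ DIM(real^'n) - norm (A y0 - q)) < e"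
    using D(1) by (simp add: AE_ball_countable)
  then show ?thesis
  proof (elim eventually_mono, intro allI impI)
    fix y0 and e :: real
    assume leb: "\<forall>q\<in>D. \<forall>e>0. \<exists>d>0. \<forall>h. 0 < h \<and> h < d \<longrightarrow>
      norm (integral (cbox y0 (y0 + h *\<^sub>R One)) (\<lambda>y. norm (A y - q)) /\<^sub>R h ^ DIM(real^'n) - norm (A y0 - q)) < e"
      and e: "0 < e"
    \<comment> \<open>Replacing \<open>A y0\<close> by \<open>q\<close> costs \<open>e / 4\<close>
      in the integrand, and the average of \<open>norm (A y - q)\<close> is below
      \<open>e / 2\<close>.\<close>
    obtain q where q: "q \<in> D" "norm (A y0 - q) < e / 4"
      using D(2)[of "ball (A y0) (e / 4)"] e by (auto simp: dist_norm)
    from leb q(1) e obtain d where d: "d > 0" "\<And>h. 0 < h \<Longrightarrow> h < d \<Longrightarrow>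
      norm (integral (cbox y0 (y0 + h *\<^sub>R One)) (\<lambda>y. norm (A y - q)) /\<^sub>R h ^ DIM(real^'n) - norm (A y0 - q)) < e / 4"
      by (metis zero_less_divide_iff zero_less_numeral)
    have "(LINT y|lborel. indicator (cbox y0 (y0 + h *\<^sub>R One)) y * norm (A y - A y0)) \<le> e * h ^ CARD('n)"
      if h: "0 < h" "h < d" for h
    proof -
      let ?Q = "cbox y0 (y0 + h *\<^sub>R One)"
      have Qm: "measure lborel ?Q = h ^ CARD('n)"
      proof -
        have "(One :: real^'n) \<bullet> i = 1" if "i \<in> Basis" for i
          using that by (simp add: inner_sum_left inner_Basis)
        then show ?thesis
          using h by (simp add: content_cbox_if box_eq_empty inner_add_left not_less less_imp_le)
      qed
      have ind: "integrable lborel (indicator ?Q :: _ \<Rightarrow> real)"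
        using emeasure_lborel_cbox_finite[of y0 "y0 + h *\<^sub>R One"]
        by (intro integrable_real_indicator) simp_all
      have int: "integrable lborel (\<lambda>y. indicator ?Q y * norm (A y - q'))" for q'
        using sint[of y0 "y0 + h *\<^sub>R One" q'] by (simp add: set_integrable_def)
      have "(LINT y|lborel. indicator ?Q y * norm (A y - A y0)) \<le>
          (LINT y|lborel. indicator ?Q y * norm (A y - q) + indicator ?Q y * (e / 4))"
      proof (rule integral_mono)
        show "indicator ?Q y * norm (A y - A y0) \<le> indicator ?Q y * norm (A y - q) + indicator ?Q y * (e / 4)" for y
          using q(2) norm_triangle_ineq4[of "A y - q" "A y0 - q"] by (auto simp: indicator_def)
      qed (use int ind in auto)
      also have "\<dots> = integral ?Q (\<lambda>y. norm (A y - q)) + h ^ CARD('n) * (e / 4)"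
        using int ind set_borel_integral_eq_integral(2)[OF sint[of y0 "y0 + h *\<^sub>R One" q]]
        by (simp add: Qm set_lebesgue_integral_def)
      also have "\<dots> \<le> e * h ^ CARD('n)"
      proof -
        define X where "X = integral ?Q (\<lambda>y. norm (A y - q))"
        define p where "p = h ^ CARD('n)"
        have p: "0 < p" using h by (simp add: p_def)
        have "X / p = X /\<^sub>R h ^ DIM(real^'n)"
          by (simp add: p_def divide_inverse_commute)
        then have "\<bar>X / p - norm (A y0 - q)\<bar> < e / 4"
          using d(2)[OF h] unfolding X_def real_norm_def by (simp only:)
        then have "X / p < e / 2" using q(2) by linarith
        then have "X < e / 2 * p" using p by (simp add: divide_less_eq)
        moreover have "0 < e * p" using e p by simp
        ultimately show ?thesis unfolding X_def[symmetric] p_def[symmetric] by (simp add: algebra_simps)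
      qed
      finally show ?thesis .
    qed
    with d(1) show "\<exists>d>0. \<forall>h. 0 < h \<and> h < d \<longrightarrow>
        (LINT y|lborel. indicator (cbox y0 (y0 + h *\<^sub>R One)) y * norm (A y - A y0)) \<le> e * h ^ CARD('n)"
      by blast
  qed
qed

end

subsection \<open>Quadratic test functions\<close>

text \<open>A quadratic with gradient \<open>p\<close> at \<open>c\<close> and Hessian
  \<open>M\<close>; it has no constant term because viscosity tests see only differences of
  values.\<close>

definition quad :: "real^'n \<Rightarrow> real^'n \<Rightarrow> real^'n^'n \<Rightarrow> real^'n::finite \<Rightarrow> real" where
  "quad c p M z = p \<bullet> (z - c) + ((z - c) \<bullet> (M *v (z - c))) / 2"

lemma inner_sym_mat: "sym_mat M \<Longrightarrow> (x::real^'n) \<bullet> (M *v y) = (M *v x) \<bullet> y"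
  by (metis dot_lmul_matrix transpose_matrix_vector)

lemma partial_quad:
  assumes "sym_mat M"
  shows "partial i (quad c p M) = (\<lambda>z. p $ i + M $ i \<bullet> (z - c))"
    and "quad c p M differentiable (at z)"
proof -
  have d: "(quad c p M has_derivative (\<lambda>h. (p + M *v (z - c)) \<bullet> h)) (at z)" for z
  proof -
    have "((\<lambda>z. M *v (z - c)) has_derivative (\<lambda>h. M *v h)) (at z)"
      by (rule has_derivative_eq_rhs[OF bounded_linear.has_derivative[OF matrix_vector_mul_bounded_linear]])
        (auto intro!: derivative_eq_intros)
    then have "((\<lambda>z. p \<bullet> (z - c) + ((z - c) \<bullet> (M *v (z - c))) / 2) has_derivative
        (\<lambda>h. p \<bullet> h + ((z - c) \<bullet> (M *v h) + h \<bullet> (M *v (z - c))) / 2)) (at z)"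
      by (auto intro!: derivative_eq_intros)
    moreover have "(z - c) \<bullet> (M *v h) = h \<bullet> (M *v (z - c))" for h
      using inner_sym_mat[OF assms, of "z - c" h] by (metis inner_commute)
    ultimately show ?thesis
      by (simp add: quad_def[abs_def] inner_add_left inner_add_right inner_commute)
  qed
  show "quad c p M differentiable (at z)" using d by (auto simp: differentiable_def)
  show "partial i (quad c p M) = (\<lambda>z. p $ i + M $ i \<bullet> (z - c))"
    by (simp add: fun_eq_iff partial_eq[OF d] inner_axis matrix_vector_mul_component)
qed

lemma partial_partial_quad:
  assumes "sym_mat M"
  shows "partial i (partial j (quad c p M)) = (\<lambda>z. M $ j $ i)"
    and "partial j (quad c p M) differentiable (at z)"
proof -
  have d: "((\<lambda>z. p $ j + M $ j \<bullet> (z - c)) has_derivative (\<lambda>h. M $ j \<bullet> h)) (at z)" for z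
    by (auto intro!: derivative_eq_intros)
  show "partial i (partial j (quad c p M)) = (\<lambda>z. M $ j $ i)"
    unfolding partial_quad[OF assms] by (simp add: fun_eq_iff partial_eq[OF d] inner_axis)
  show "partial j (quad c p M) differentiable (at z)"
    unfolding partial_quad[OF assms] using d by (auto simp: differentiable_def)
qed

lemma C2_quad: "sym_mat M \<Longrightarrow> C2 (quad c p M)"
  by (simp add: C2_iff partial_quad(2) partial_partial_quad)

lemma grad_quad: "sym_mat M \<Longrightarrow> grad (quad c p M) z = p + M *v (z - c)"
  by (simp add: grad_def partial_quad vec_eq_iff matrix_vector_mul_component)

lemma hessian_quad: "sym_mat M \<Longrightarrow> hessian (quad c p M) z = M"
  by (simp add: hessian_def partial_partial_quad(1)) (simp add: transpose_def)

subsection \<open>The operator\<close>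

lemma sym_mat_simps:
  "sym_mat M \<Longrightarrow> sym_mat N \<Longrightarrow> sym_mat (M + N)"
  "sym_mat M \<Longrightarrow> sym_mat N \<Longrightarrow> sym_mat (M - N)"
  "sym_mat M \<Longrightarrow> sym_mat (t *\<^sub>R M)"
  "sym_mat (mat t)"
  by (auto simp: transpose_def vec_eq_iff mat_def)

lemma psd_trace_nonneg:
  fixes N :: "real^'n^'n"
  assumes "psd N" shows "0 \<le> trace N"
proof -
  have "N $ i $ i = axis i 1 \<bullet> (N *v axis i 1)" for i
    by (simp add: matrix_vector_mult_basis column_def inner_axis')
  then show ?thesis using assms by (auto simp: trace_def psd_def intro!: sum_nonneg)
qed

text \<open>Ellipticity controls only positive semidefinite increments. With
  \<open>r = norm (M - N)\<close>, both \<open>mat r\<close> and \<open>P = mat r - (M - N)\<close>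
  are such increments and \<open>M + P = N + mat r\<close>; adding \<open>P\<close> does not
  increase \<open>F\<close>, and adding \<open>mat r\<close> lowers it by at most \<Theta> times its
  trace.\<close>

lemma operator_Lipschitz:
  fixes F :: "real^'n::finite^'n \<Rightarrow> real"
  assumes "admissible_operator F"
  obtains L where "0 \<le> L" "\<And>M N. sym_mat M \<Longrightarrow> sym_mat N \<Longrightarrow> F N - L * norm (M - N) \<le> F M"
proof -
  obtain \<theta> \<Theta> where c: "0 \<le> \<theta>" "0 \<le> \<Theta>"
    and ell: "\<And>M N. sym_mat M \<Longrightarrow> psd N \<Longrightarrow>
        - \<Theta> * trace N \<le> F (M + N) - F M \<and> F (M + N) - F M \<le> - \<theta> * trace N"
    using assms unfolding admissible_operator_def by blast
  have "F N - \<Theta> * real CARD('n) * norm (M - N) \<le> F M" if s: "sym_mat M" "sym_mat N" for M N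
  proof -
    define r where "r = norm (M - N)"
    define P where "P = mat r - (M - N)"
    have "mat r *v v = r *\<^sub>R v" for v :: "real^'n"
      by (simp add: vec_eq_iff matrix_vector_mult_def mat_def if_distrib[where f = "\<lambda>x. x * _"]
          cong: if_cong)
    then have mat: "v \<bullet> (mat r *v v) = r * (norm v)\<^sup>2" for v :: "real^'n"
      by (simp add: power2_norm_eq_inner)
    have "psd P" unfolding psd_def
    proof (intro conjI allI)
      show "sym_mat P" unfolding P_def using s by (intro sym_mat_simps)
      fix v
      have "v \<bullet> (P *v v) = r * (norm v)\<^sup>2 - v \<bullet> ((M - N) *v v)"
        by (simp only: P_def matrix_vector_mult_diff_rdistrib[of "mat r"] inner_diff_right mat)
      moreover have "v \<bullet> ((M - N) *v v) \<le> r * (norm v)\<^sup>2"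
        using abs_inner_matrix_le(1)[of v "M - N" v] by (simp only: r_def power2_eq_square mult.assoc abs_le_iff)
      ultimately show "0 \<le> v \<bullet> (P *v v)" by linarith
    qed
    moreover have "psd (mat r :: real^'n^'n)"
      unfolding psd_def mat by (simp add: sym_mat_simps) (simp add: r_def)
    moreover have "M + P = N + mat r" by (simp add: P_def)
    moreover have "trace (mat r :: real^'n^'n) = real CARD('n) * r"
      by (simp add: trace_def mat_def)
    moreover have "0 \<le> \<theta> * trace P" using c psd_trace_nonneg[OF \<open>psd P\<close>] by simp
    ultimately show ?thesis
      using ell[OF s(1), of P] ell[OF s(2), of "mat r"] by (simp add: r_def algebra_simps)
  qed
  then show thesis using c by (intro that[of "\<Theta> * real CARD('n)"]) auto
qed

text \<open>Pairing matrix and point makes one closed convex set out of the inequality, so that a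
  single averaging argument handles \<open>F\<close> and \<open>f\<close> together.\<close>

lemma closed_operator_superlevel:
  fixes F :: "real^'n::finite^'n \<Rightarrow> real" and f :: "real^'n \<Rightarrow> real"
  assumes "admissible_operator F" "continuous_on UNIV f"
  shows "closed {(M, y). sym_mat M \<and> f y - lam \<le> F M}"
  unfolding closed_sequential_limits
proof (intro allI impI, elim conjE)
  fix X and l :: "(real^'n^'n) \<times> (real^'n)"
  assume X: "\<forall>k. X k \<in> {(M, y). sym_mat M \<and> f y - lam \<le> F M}" and lim: "X \<longlonglongrightarrow> l"
  obtain L where L: "0 \<le> L" "\<And>M N. sym_mat M \<Longrightarrow> sym_mat N \<Longrightarrow> F N - L * norm (M - N) \<le> F M"
    using operator_Lipschitz[OF assms(1)] by blast
  have s: "sym_mat (fst (X k))" "f (snd (X k)) - lam \<le> F (fst (X k))" for k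
    using X by (auto simp: case_prod_beta)
  have lf: "(\<lambda>k. fst (X k)) \<longlonglongrightarrow> fst l" and ls: "(\<lambda>k. snd (X k)) \<longlonglongrightarrow> snd l"
    using lim by (auto intro: tendsto_intros)
  have "closed {M :: real^'n^'n. transpose M = M}"
    unfolding transpose_def by (intro closed_Collect_eq continuous_intros)
  then have sl: "sym_mat (fst l)"
    using closed_sequentially[of "{M. transpose M = M}" "\<lambda>k. fst (X k)"] s(1) lf by simp
  have "f (snd l) - lam - L * norm (fst l - fst l) \<le> F (fst l)"
  proof (rule tendsto_le[OF _ tendsto_const, of sequentially])
    have "(\<lambda>k. f (snd (X k))) \<longlonglongrightarrow> f (snd l)"
      using assms(2) ls isCont_tendsto_compose[of "snd l" f] by (simp add: continuous_on_eq_continuous_at)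
    then show "(\<lambda>k. f (snd (X k)) - lam - L * norm (fst l - fst (X k))) \<longlonglongrightarrow>
        f (snd l) - lam - L * norm (fst l - fst l)"
      by (intro tendsto_intros lf)
    show "\<forall>\<^sub>F k in sequentially. f (snd (X k)) - lam - L * norm (fst l - fst (X k)) \<le> F (fst l)"
      using s L(2)[OF sl s(1)] by (intro always_eventually allI) (smt (verit))
  qed simp
  with sl show "l \<in> {(M, y). sym_mat M \<and> f y - lam \<le> F M}" by (simp add: case_prod_beta)
qed

text \<open>Superadditivity and homogeneity together make \<open>F\<close> concave on symmetric
  matrices.\<close>

lemma convex_operator_superlevel:
  fixes F :: "real^'n::finite^'n \<Rightarrow> real" and f :: "real^'n \<Rightarrow> real"
  assumes F: "admissible_operator F" and f: "convex_on UNIV f"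
  shows "convex {(M, y). sym_mat M \<and> f y - lam \<le> F M}"
proof (rule convexI)
  fix z z' :: "(real^'n^'n) \<times> (real^'n)" and a b :: real
  assume z: "z \<in> {(M, y). sym_mat M \<and> f y - lam \<le> F M}" "z' \<in> {(M, y). sym_mat M \<and> f y - lam \<le> F M}"
    and ab: "0 \<le> a" "0 \<le> b" "a + b = 1"
  obtain M x N y where zz: "z = (M, x)" "z' = (N, y)" by (metis surj_pair)
  with z have s: "sym_mat M" "sym_mat N" and le: "f x - lam \<le> F M" "f y - lam \<le> F N" by auto
  have "sym_mat (a *\<^sub>R M + b *\<^sub>R N)" using s by (intro sym_mat_simps)
  have "f (a *\<^sub>R x + b *\<^sub>R y) \<le> a * f x + b * f y"
    using f ab by (auto simp: convex_on_def)
  moreover have "a * (f x - lam) + b * (f y - lam) \<le> a * F M + b * F N"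
    using le ab by (intro add_mono mult_left_mono)
  moreover have "a * F M + b * F N \<le> F (a *\<^sub>R M + b *\<^sub>R N)"
    using F s ab sym_mat_simps(3) unfolding admissible_operator_def by metis
  moreover have "a * lam + b * lam = lam" using ab by (metis distrib_right mult_1)
  ultimately show "a *\<^sub>R z + b *\<^sub>R z' \<in> {(M, y). sym_mat M \<and> f y - lam \<le> F M}"
    using \<open>sym_mat (a *\<^sub>R M + b *\<^sub>R N)\<close> by (simp add: zz right_diff_distrib)
qed

subsection \<open>The supersolution property almost everywhere\<close>

lemma One_vec_nth: "(One :: real^'n::finite) $ i = 1"
proof -
  have "(One :: real^'n) \<bullet> axis i 1 = 1"
    by (simp only: inner_sum_left) (simp add: inner_Basis)
  then show ?thesis by (simp add: inner_axis)
qed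

context bounded_hessian
begin

text \<open>The sup bound of the kernel trades the weighted average for an integral over a box, the
  form that Lebesgue points control; the box need not be centred at \<open>x\<close>.\<close>

lemma norm_hessian_mollify_diff_le_integral:
  assumes K: "mollifier B' \<rho> K" and Q: "\<And>y. norm (y - x) \<le> \<rho> \<Longrightarrow> y \<in> cbox a b"
  shows "norm (hessian (mollify K u) x - M) \<le>
    B' / \<rho> ^ CARD('n) * (LINT y|lborel. indicator (cbox a b) y * norm (A y - M))"
proof -
  note KD = mollifierD[OF K]
  note int = integrable_mollify_A[OF K, of x] mollifier_translate(1)[OF K, of x]
  have iQ: "integrable lborel (\<lambda>y. indicator (cbox a b) y * norm (A y - M))"
  proof (rule Bochner_Integration.integrable_bound)
    show "integrable lborel (\<lambda>y. indicator (cbox a b) y * (C + norm M))"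
      using emeasure_lborel_cbox_finite[of a b] by (intro integrable_mult_left) simp
    show "AE y in lborel. norm (indicator (cbox a b) y * norm (A y - M)) \<le>
        norm (indicator (cbox a b) y * (C + norm M))"
    proof (intro AE_I2)
      fix y
      have "norm (A y - M) \<le> C + norm M" using A_bound[of y] norm_triangle_ineq4[of "A y" M] by linarith
      then show "norm (indicator (cbox a b) y * norm (A y - M)) \<le>
        norm (indicator (cbox a b) y * (C + norm M))"
        using C_nonneg by (auto simp: indicator_def)
    qed
  qed simp
  have "hessian (mollify K u) x - M = (LINT y|lborel. K (y - x) *\<^sub>R A y - K (y - x) *\<^sub>R M)"
    using int by (simp add: hessian_mollify[OF K] mollifier_translate(2)[OF K])
  also have "norm \<dots> \<le> (LINT y|lborel. B' / \<rho> ^ CARD('n) * (indicator (cbox a b) y * norm (A y - M)))"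
  proof (rule Bochner_Integration.integral_norm_bound_integral)
    show "norm (K (y - x) *\<^sub>R A y - K (y - x) *\<^sub>R M) \<le>
        B' / \<rho> ^ CARD('n) * (indicator (cbox a b) y * norm (A y - M))" for y
    proof (cases "norm (y - x) \<le> \<rho>")
      case True
      have "K (y - x) * norm (A y - M) \<le> B' / \<rho> ^ CARD('n) * norm (A y - M)"
        using KD(3) by (intro mult_right_mono) auto
      then show ?thesis using KD(2)[of "y - x"] Q[OF True] by (simp flip: scaleR_right_diff_distrib)
    next
      case False
      have "0 \<le> B' / \<rho> ^ CARD('n)" using KD(2,3)[of 0] by linarith
      then have "0 \<le> B' / \<rho> ^ CARD('n) * (indicator (cbox a b) y * norm (A y - M))"
        by (intro mult_nonneg_nonneg) auto
      then show ?thesis using KD(5) False by simp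
    qed
  qed (use int iQ in auto)
  finally show ?thesis by simp
qed

text \<open>In a ball inside a small cube at \<open>y0\<close>, a mollification \<open>w\<close> at
  a much finer scale has Hessian close to \<open>A y0\<close>. A quadratic that bends slightly less
  than \<open>w\<close> touches \<open>u\<close> from below inside the ball; its gradient stays
  where \<open>H < 0\<close>, so the operator inequality holds at the contact point.\<close>

lemma supersolution_at_Lebesgue_point:
  fixes F :: "real^'n^'n \<Rightarrow> real" and f H :: "real^'n \<Rightarrow> real"
  assumes sup: "viscosity_supersolution F H f lam u" and F: "admissible_operator F"
    and f: "continuous_on UNIV f" and K: "mollifier B' \<epsilon> K" and \<epsilon>: "0 < \<epsilon>"
    and H: "\<And>p. norm (p - grad (mollify K u) x) < \<eta> \<Longrightarrow> H p < 0" and \<eta>: "4 * C * \<epsilon> < \<eta>"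
    and y0: "norm (y0 - x) \<le> \<epsilon>"
    and leb: "\<forall>e>0. \<exists>d>0. \<forall>h. 0 < h \<and> h < d \<longrightarrow>
      (LINT y|lborel. indicator (cbox y0 (y0 + h *\<^sub>R One)) y * norm (A y - A y0)) \<le> e * h ^ CARD('n)"
  shows "f y0 - lam \<le> F (A y0)"
proof -
  obtain L where L: "0 \<le> L" "\<And>M N. sym_mat M \<Longrightarrow> sym_mat N \<Longrightarrow> F N - L * norm (M - N) \<le> F M"
    using operator_Lipschitz[OF F] by blast
  define m where "m = norm (mat 1 :: real^'n^'n)"
  define k where "k = norm (One :: real^'n)"
  have m: "0 \<le> m" and k: "0 \<le> k" by (simp_all add: m_def k_def)
  \<comment> \<open>One \<kappa> pays for moving \<open>f\<close> from \<open>y0\<close> to the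
    contact point, the rest for the lowered Hessian.\<close>
  have main: "f y0 - lam \<le> F (A y0) + \<kappa> * (1 + 2 * L * m)" if \<kappa>: "0 < \<kappa>" for \<kappa>
  proof -
    \<comment> \<open>The ratio of mollification scale to cube size. Mollification error and gap on
      the sphere both scale like the square of the size, so the requirement
      \<open>32 * C * \<delta>\<^sup>2 < \<kappa>\<close> does not involve the size.\<close>
    define \<delta> where "\<delta> = min (1 / 4) (\<kappa> / (16 * (C + 1)))"
    have \<delta>: "0 < \<delta>" "\<delta> \<le> 1 / 4" "32 * C * \<delta>\<^sup>2 < \<kappa>"
    proof -
      show "0 < \<delta>" using \<kappa> C_nonneg by (simp add: \<delta>_def)
      show "\<delta> \<le> 1 / 4" unfolding \<delta>_def by (rule min.cobounded1)
      have "\<delta> * \<delta> \<le> (1 / 4) * (\<kappa> / (16 * (C + 1)))"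
      proof (rule mult_mono)
        show "\<delta> \<le> \<kappa> / (16 * (C + 1))" unfolding \<delta>_def by (rule min.cobounded2)
      qed (use \<open>0 < \<delta>\<close> \<open>\<delta> \<le> 1 / 4\<close> in auto)
      then have "32 * C * \<delta>\<^sup>2 \<le> 32 * C * ((1 / 4) * (\<kappa> / (16 * (C + 1))))"
        unfolding power2_eq_square using C_nonneg by (intro mult_left_mono) auto
      also have "\<dots> = \<kappa> * (C / (2 * (C + 1)))" using C_nonneg by (simp add: field_simps)
      also have "\<dots> < \<kappa> * 1"
        using \<kappa> C_nonneg by (intro mult_strict_left_mono) (simp_all add: field_simps)
      finally show "32 * C * \<delta>\<^sup>2 < \<kappa>" by simp
    qed
    \<comment> \<open>Cancels the factor \<open>B / \<rho> ^ CARD('n)\<close> of the Hessian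
      estimate once \<open>\<rho> = \<delta> * r\<close>.\<close>
    define e where "e = \<kappa> * \<delta> ^ CARD('n) / (B + 1)"
    have e: "0 < e" using \<kappa> \<delta> B_nonneg by (simp add: e_def)
    obtain d where d: "d > 0" "\<And>h. 0 < h \<Longrightarrow> h < d \<Longrightarrow>
      (LINT y|lborel. indicator (cbox y0 (y0 + h *\<^sub>R One)) y * norm (A y - A y0)) \<le> e * h ^ CARD('n)"
      using leb e by blast
    obtain d1 where d1: "d1 > 0" "\<And>y. dist y y0 < d1 \<Longrightarrow> dist (f y) (f y0) < \<kappa>"
      using f \<kappa> unfolding continuous_on_iff by blast
    \<comment> \<open>Bounds the part of the gradient error proportional to \<open>r\<close>: the
      distance from \<open>y0\<close> to the cube's centre, and the norm of the quadratic's Hessian.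
      The 1 ensures positivity.\<close>
    define S where "S = C * k + (C + 2 * \<kappa> * m) + 1"
    have S: "0 < S" using C_nonneg k m \<kappa> by (simp add: S_def add_nonneg_pos)
    define r where "r = min (min (d / 2) \<epsilon>) (min (d1 / (2 * (k + 1))) ((\<eta> - 4 * C * \<epsilon>) / (2 * S)))"
    have r: "0 < r" "r < d" "r \<le> \<epsilon>" "r * (k + 1) < d1" "4 * C * \<epsilon> + r * S < \<eta>"
    proof -
      show "0 < r" "r < d" "r \<le> \<epsilon>" using d(1) d1(1) \<epsilon> S \<eta> k by (auto simp: r_def)
      have "r \<le> d1 / (2 * (k + 1))" "r \<le> (\<eta> - 4 * C * \<epsilon>) / (2 * S)" by (simp_all add: r_def)
      then have 1: "r * (k + 1) \<le> d1 / 2" and 2: "r * S \<le> (\<eta> - 4 * C * \<epsilon>) / 2"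
        using k S by (simp_all add: field_simps)
      show "r * (k + 1) < d1" using 1 d1(1) by linarith
      note 2
      also have "(\<eta> - 4 * C * \<epsilon>) / 2 < \<eta> - 4 * C * \<epsilon>" using \<eta> by simp
      finally show "4 * C * \<epsilon> + r * S < \<eta>" by simp
    qed
    \<comment> \<open>A ball of radius \<open>R\<close> about the cube's centre, enlarged by
      \<open>\<rho> \<le> R\<close>, still fits into the cube.\<close>
    define R where "R = r / 4"
    define \<rho> where "\<rho> = \<delta> * r"
    have R: "0 < R" using r by (simp add: R_def)
    have \<rho>: "0 < \<rho>" "\<rho> \<le> R" "\<rho> \<le> \<epsilon>"
    proof -
      show "0 < \<rho>" "\<rho> \<le> R" using \<delta> r by (auto simp: \<rho>_def R_def)
      then show "\<rho> \<le> \<epsilon>" using r by (simp add: R_def)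
    qed
    define c where "c = y0 + (r / 2) *\<^sub>R One"
    have cy0: "norm (c - y0) = r / 2 * k" using r by (simp add: c_def k_def)
    obtain K\<rho> :: "real^'n \<Rightarrow> real" where K\<rho>: "mollifier B \<rho> K\<rho>" using mollifiers[OF \<rho>(1)] by blast
    define w where "w = mollify K\<rho> u"
    \<comment> \<open>One \<kappa> absorbs the deviation of the Hessian of \<open>w\<close>; the
      other leaves a gap of half \<open>\<kappa> * R\<^sup>2\<close> on the sphere, more than the
      total mollification error \<open>C * \<rho>\<^sup>2\<close>.\<close>
    define M where "M = A y0 - (2 * \<kappa>) *\<^sub>R mat 1"
    have symM: "sym_mat M" unfolding M_def using A_sym by (intro sym_mat_simps)
    have hess: "norm (hessian w z - A y0) \<le> \<kappa>" if "norm (z - c) \<le> R" for z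
    proof -
      have Q: "y \<in> cbox y0 (y0 + r *\<^sub>R One)" if y: "norm (y - z) \<le> \<rho>" for y
      proof -
        have "norm (y - c) \<le> norm (y - z) + norm (z - c)"
          using norm_triangle_ineq[of "y - z" "z - c"] by simp
        then have "norm (y - c) \<le> r / 2"
          using y \<open>norm (z - c) \<le> R\<close> \<rho>(2) by (simp add: R_def)
        then have 1: "\<bar>(y - c) $ i\<bar> \<le> r / 2" for i
          using component_le_norm_cart order_trans by blast
        have 2: "c $ i = y0 $ i + r / 2" "(y0 + r *\<^sub>R One) $ i = y0 $ i + r" for i
          unfolding c_def vector_add_component vector_scaleR_component One_vec_nth by simp_all
        have "y0 $ i \<le> y $ i \<and> y $ i \<le> (y0 + r *\<^sub>R One) $ i" for i
          using 1[of i] unfolding vector_minus_component 2 by linarith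
        then show ?thesis unfolding mem_box_cart by blast
      qed
      have "norm (hessian w z - A y0) \<le>
          B / \<rho> ^ CARD('n) * (LINT y|lborel. indicator (cbox y0 (y0 + r *\<^sub>R One)) y * norm (A y - A y0))"
        unfolding w_def by (rule norm_hessian_mollify_diff_le_integral[OF K\<rho> Q])
      also have "\<dots> \<le> B / \<rho> ^ CARD('n) * (e * r ^ CARD('n))"
        using d(2)[OF r(1,2)] B_nonneg \<rho> by (intro mult_left_mono) auto
      also have "\<dots> = \<kappa> * (B / (B + 1))"
        using \<delta>(1) r(1) B_nonneg by (simp add: e_def \<rho>_def power_mult_distrib)
      also have "\<dots> \<le> \<kappa> * 1"
        using B_nonneg \<kappa> by (intro mult_left_mono) simp_all
      finally show ?thesis by simp
    qed
    define \<phi> where "\<phi> = quad c (grad w c) M"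
    have mat1: "v \<bullet> (M *v v) = v \<bullet> (A y0 *v v) - 2 * (\<kappa> * (norm v)\<^sup>2)" for v :: "real^'n"
      by (simp add: M_def matrix_vector_mult_diff_rdistrib inner_diff_right scaleR_matrix_vector_assoc[symmetric]
          power2_norm_eq_inner)
    have small: "2 * (C * \<rho>\<^sup>2) < \<kappa> * R\<^sup>2"
    proof -
      have "32 * C * \<delta>\<^sup>2 * r\<^sup>2 < \<kappa> * r\<^sup>2" using \<delta>(3) r(1) by (intro mult_strict_right_mono) auto
      then show ?thesis by (simp add: \<rho>_def R_def power_mult_distrib power_divide)
    qed
    have err: "\<bar>w z - u z\<bar> \<le> C * \<rho>\<^sup>2 / 2" for z unfolding w_def by (rule mollify_error[OF K\<rho>])
    define g where "g z = u z - \<phi> z" for z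
    have bd: "g c < g z" if z: "norm (z - c) = R" for z
    proof -
      obtain t where t: "0 < t" "t \<le> 1" "w (c + (z - c)) = w c + grad w c \<bullet> (z - c) +
          (z - c) \<bullet> (hessian w (c + t *\<^sub>R (z - c)) *v (z - c)) / 2"
        using Taylor2[OF C2_mollify[OF K\<rho>], folded w_def] by metis
      let ?h = "z - c" and ?N = "hessian w (c + t *\<^sub>R (z - c)) - A y0"
      have "t * norm ?h \<le> R" using t(1,2) z R mult_right_mono[of t 1 R] by simp
      then have "norm ?N \<le> \<kappa>" using t(1) by (intro hess) simp
      then have "norm ?N * norm ?h * norm ?h \<le> \<kappa> * norm ?h * norm ?h"
        by (intro mult_right_mono) auto
      then have "\<bar>?h \<bullet> (?N *v ?h)\<bar> \<le> \<kappa> * R\<^sup>2"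
        using abs_inner_matrix_le(1)[of ?h ?N ?h] unfolding z by (simp add: power2_eq_square mult.assoc)
      then have "?h \<bullet> (A y0 *v ?h) - \<kappa> * R\<^sup>2 \<le> ?h \<bullet> (hessian w (c + t *\<^sub>R ?h) *v ?h)"
        by (simp add: matrix_vector_mult_diff_rdistrib inner_diff_right abs_le_iff)
      moreover have "\<phi> z = grad w c \<bullet> ?h + (?h \<bullet> (A y0 *v ?h) - 2 * (\<kappa> * R\<^sup>2)) / 2"
        unfolding \<phi>_def quad_def mat1 z ..
      moreover have "\<phi> c = 0" by (simp add: \<phi>_def quad_def)
      moreover have "w z = w c + grad w c \<bullet> ?h + ?h \<bullet> (hessian w (c + t *\<^sub>R ?h) *v ?h) / 2"
        using t(3) by simp
      moreover have "w c \<ge> u c - C * \<rho>\<^sup>2 / 2" "u z \<ge> w z - C * \<rho>\<^sup>2 / 2"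
        using err[of c] err[of z] unfolding abs_le_iff by linarith+
      \<comment> \<open>The comparison as linear arithmetic: \<open>a\<close> and \<open>b\<close>
        are second-order terms, \<open>q\<close> is the gap scale, \<open>s\<close> the
        mollification error and \<open>l\<close> the common first-order term.\<close>
      moreover have "uc - pc < uz - pz" if "a - q \<le> b" "pz = l + (a - 2 * q) / 2" "pc = 0"
        "wz = wc + l + b / 2" "uc - s / 2 \<le> wc" "wz - s / 2 \<le> uz" "2 * s < q"
        for a b q s l pc pz wc wz uc uz :: real
        using that by (simp add: field_simps)
      ultimately show ?thesis using small unfolding g_def by blast
    qed
    have "continuous_on UNIV g"
      unfolding g_def using continuous_u Ck_imp_continuous[OF C2_quad[OF symM]]
      by (intro continuous_intros) (simp_all add: \<phi>_def)
    then have "\<exists>y1\<in>cball c R. \<forall>z\<in>cball c R. g y1 \<le> g z"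
      using R by (intro continuous_attains_inf) (auto intro: continuous_on_subset)
    then obtain y1 where y1: "y1 \<in> cball c R" "\<And>z. z \<in> cball c R \<Longrightarrow> g y1 \<le> g z" by blast
    have "norm (y1 - c) \<noteq> R" using bd[of y1] y1(2)[of c] R by auto
    then have y1R: "norm (y1 - c) < R" using y1(1) by (simp add: dist_norm norm_minus_commute)
    then have "\<forall>\<^sub>F z in nhds y1. z \<in> ball c R"
      by (intro eventually_nhds_in_open) (auto simp: dist_norm norm_minus_commute)
    then have "\<forall>\<^sub>F z in nhds y1. u y1 - \<phi> y1 \<le> u z - \<phi> z"
      by (rule eventually_mono) (use y1(2) in \<open>auto simp: g_def\<close>)
    then have pde: "0 \<le> pde_op F H f lam \<phi> y1"
      using sup C2_quad[OF symM] unfolding viscosity_supersolution_def \<phi>_def by blast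
    \<comment> \<open>Three of the four multiples of \<open>C * \<epsilon>\<close> come from
      exchanging the kernels, the fourth from \<open>norm (y0 - x) \<le> \<epsilon>\<close>.\<close>
    have "norm (grad \<phi> y1 - grad (mollify K u) x) < \<eta>"
    proof -
      have "grad \<phi> y1 - grad (mollify K u) x =
          (grad w c - grad (mollify K u) c) + (grad (mollify K u) c - grad (mollify K u) x) + M *v (y1 - c)"
        by (simp add: \<phi>_def grad_quad[OF symM])
      also have "norm \<dots> \<le> norm (grad w c - grad (mollify K u) c) +
          norm (grad (mollify K u) c - grad (mollify K u) x) + norm (M *v (y1 - c))"
        by (intro norm_triangle_le add_mono norm_triangle_ineq order_refl)
      also have "norm (grad w c - grad (mollify K u) c) \<le> 3 * C * \<epsilon>"
        unfolding w_def by (rule grad_mollify_diff_le[OF K\<rho> K \<rho>(1,3)])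
      also have "norm (grad (mollify K u) c - grad (mollify K u) x) \<le> C * (r / 2 * k + \<epsilon>)"
      proof -
        have "norm (c - x) \<le> r / 2 * k + \<epsilon>"
          using norm_triangle_ineq[of "c - y0" "y0 - x"] y0 cy0 by simp
        then show ?thesis
          using grad_mollify_Lipschitz[OF K, of c x] C_nonneg mult_left_mono order_trans by blast
      qed
      also have "norm (M *v (y1 - c)) \<le> (C + 2 * \<kappa> * m) * r"
      proof -
        have "norm M \<le> norm (A y0) + norm ((2 * \<kappa>) *\<^sub>R mat 1 :: real^'n^'n)"
          unfolding M_def by (rule norm_triangle_ineq4)
        then have "norm M \<le> C + 2 * \<kappa> * m" using A_bound[of y0] \<kappa> by (simp add: m_def)
        moreover have "norm (y1 - c) \<le> r" using y1R R by (simp add: R_def)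
        ultimately have "norm M * norm (y1 - c) \<le> (C + 2 * \<kappa> * m) * r"
          using C_nonneg \<kappa> m by (intro mult_mono) auto
        with abs_inner_matrix_le(2) show ?thesis by (rule order_trans)
      qed
      also have "3 * C * \<epsilon> + C * (r / 2 * k + \<epsilon>) + (C + 2 * \<kappa> * m) * r \<le> 4 * C * \<epsilon> + r * S"
      proof -
        have "0 \<le> C * r * k" using C_nonneg r k by simp
        then show ?thesis using r(1) by (simp add: S_def algebra_simps)
      qed
      finally show ?thesis using r(5) by simp
    qed
    then have "H (grad \<phi> y1) < 0" by (rule H)
    with pde have "f y1 - lam \<le> F M"
      by (simp add: pde_op_def le_max_iff_disj \<phi>_def hessian_quad[OF symM])
    moreover have "f y0 - \<kappa> < f y1"
    proof -
      have "norm (y1 - y0) \<le> norm (y1 - c) + norm (c - y0)"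
        using norm_triangle_ineq[of "y1 - c" "c - y0"] by simp
      also have "\<dots> \<le> r * (k + 1)"
      proof -
        have "0 \<le> r * k" "norm (y1 - c) \<le> r / 4" using r(1) k y1R by (simp_all add: R_def)
        then show ?thesis using r(1) unfolding cy0 by (simp add: algebra_simps)
      qed
      finally have "dist (f y1) (f y0) < \<kappa>" using r(4) by (intro d1(2)) (simp add: dist_norm)
      then show ?thesis by (simp add: dist_real_def abs_less_iff)
    qed
    moreover have "F M - L * (2 * \<kappa> * m) \<le> F (A y0)"
    proof -
      have "norm (A y0 - M) = 2 * \<kappa> * m" using \<kappa> by (simp add: M_def m_def)
      then show ?thesis using L(2)[OF A_sym[of y0] symM] by (simp only:)
    qed
    ultimately show ?thesis by (simp add: algebra_simps)
  qed
  show ?thesis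
  proof (rule field_le_epsilon)
    fix e :: real assume "0 < e"
    have s: "0 < 1 + 2 * L * m" using L m by (simp add: add_pos_nonneg)
    show "f y0 - lam \<le> F (A y0) + e"
      using main[of "e / (1 + 2 * L * m)"] \<open>0 < e\<close> s by simp
  qed
qed

text \<open>Jensen's inequality in geometric form: a hyperplane strictly separating the mean from
  \<open>S\<close> would be contradicted by integrating against the kernel, which is a probability
  density.\<close>

lemma mollify_mean_in_closed_convex:
  fixes S :: "((real^'n^'n) \<times> (real^'n)) set"
  assumes K: "mollifier B' \<epsilon> K" and S: "closed S" "convex S"
    and ae: "AE y in lborel. norm (y - x) \<le> \<epsilon> \<longrightarrow> (A y, y) \<in> S"
  shows "(hessian (mollify K u) x, x) \<in> S"
proof (rule ccontr)
  let ?z = "(hessian (mollify K u) x, x)"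
  assume "?z \<notin> S"
  then obtain a b where ab: "a \<bullet> ?z < b" "\<And>k. k \<in> S \<Longrightarrow> b < a \<bullet> k"
    using separating_hyperplane_closed_point[OF S(2,1)] by blast
  obtain p q where a: "a = (p, q)" by (cases a)
  note KD = mollifierD[OF K]
  have lin: "continuous_on UNIV (\<lambda>y. q \<bullet> y)" by (intro continuous_intros)
  have i1: "integrable lborel (\<lambda>y. K (y - x) * (p \<bullet> A y))"
    using integrable_inner_right[OF integrable_mollify_A[OF K, of x], of p] by simp
  have i2: "integrable lborel (\<lambda>y. K (y - x) * (q \<bullet> y))"
    using integrable_mollify[OF KD(1) lin] .
  note i3 = mollifier_translate(1)[OF K, of x]
  have "p \<bullet> hessian (mollify K u) x = (LINT y|lborel. K (y - x) * (p \<bullet> A y))"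
    unfolding hessian_mollify[OF K]
    using integral_inner_right[OF integrable_mollify_A[OF K, of x], of p] by simp
  \<comment> \<open>Linear functions have zero second differences, so an even kernel reproduces them
    exactly.\<close>
  moreover have "q \<bullet> x = (LINT y|lborel. K (y - x) * (q \<bullet> y))"
    using mollify_error_second_difference[OF K lin, of 0 x]
    by (simp add: mollify_def inner_add_right inner_diff_right)
  moreover have "b = (LINT y|lborel. K (y - x) * b)"
    by (simp add: mollifier_translate(2)[OF K])
  ultimately have "a \<bullet> ?z - b =
      (LINT y|lborel. K (y - x) * (p \<bullet> A y) + K (y - x) * (q \<bullet> y) - K (y - x) * b)"
    using i1 i2 i3 by (simp add: a)
  also have "0 \<le> \<dots>"
  proof (rule integral_nonneg_AE)
    show "AE y in lborel. 0 \<le> K (y - x) * (p \<bullet> A y) + K (y - x) * (q \<bullet> y) - K (y - x) * b"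
      using ae
    proof (elim eventually_mono)
      fix y assume y: "norm (y - x) \<le> \<epsilon> \<longrightarrow> (A y, y) \<in> S"
      show "0 \<le> K (y - x) * (p \<bullet> A y) + K (y - x) * (q \<bullet> y) - K (y - x) * b"
      proof (cases "norm (y - x) \<le> \<epsilon>")
        case True
        then have "b < p \<bullet> A y + q \<bullet> y" using ab(2)[of "(A y, y)"] y by (simp add: a)
        then have "K (y - x) * b \<le> K (y - x) * (p \<bullet> A y + q \<bullet> y)"
          using KD(2) by (intro mult_left_mono) auto
        then show ?thesis by (simp add: distrib_left)
      qed (use KD(5) in simp)
    qed
  qed
  finally show False using ab(1) by simp
qed

lemma mollified_test_function:
  fixes F :: "real^'n^'n \<Rightarrow> real" and f H :: "real^'n \<Rightarrow> real"
  assumes sup: "viscosity_supersolution F H f lam u" and F: "admissible_operator F"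
    and H: "admissible_gradient_constraint H" and f: "convex_on UNIV f" and s: "1 < s"
  obtains U D where "C2 U" "\<And>x. \<bar>U x - u x\<bar> \<le> D"
    "\<And>x. H (s *\<^sub>R grad U x) < 0 \<Longrightarrow> f x - lam \<le> F (hessian U x)"
proof -
  have cf: "continuous_on UNIV f" using f by (intro convex_on_continuous) auto
  define W where "W = (\<lambda>p. (1 / s) *\<^sub>R p) ` {p. H p \<le> 0}"
  have "compact W" unfolding W_def
    using H by (intro compact_scaling) (simp add: admissible_gradient_constraint_def)
  moreover have "open {p. H p < 0}"
    using H by (intro open_Collect_less) (auto simp: admissible_gradient_constraint_def)
  moreover have "W \<subseteq> {p. H p < 0}"
    using gradient_constraint_scale[OF H, of _ "1 / s"] s by (auto simp: W_def)
  ultimately obtain \<eta> where \<eta>: "0 < \<eta>" "(\<Union>q\<in>W. ball q \<eta>) \<subseteq> {p. H p < 0}"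
    using compact_subset_open_imp_ball_epsilon_subset by metis
  \<comment> \<open>The 4 is the number of multiples of \<open>C * \<epsilon>\<close> by which the
    gradient of a touching quadratic may stray; adding 1 covers \<open>C = 0\<close>.\<close>
  define \<epsilon> where "\<epsilon> = \<eta> / (4 * C + 1)"
  have \<epsilon>: "0 < \<epsilon>" "4 * C * \<epsilon> < \<eta>"
    using \<eta>(1) C_nonneg by (simp_all add: \<epsilon>_def field_simps)
  obtain K :: "real^'n \<Rightarrow> real" where K: "mollifier B \<epsilon> K" using mollifiers[OF \<epsilon>(1)] by blast
  show thesis
  proof (rule that)
    show "C2 (mollify K u)" by (rule C2_mollify[OF K])
    show "\<bar>mollify K u x - u x\<bar> \<le> C * \<epsilon>\<^sup>2 / 2" for x by (rule mollify_error[OF K])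
    fix x assume x: "H (s *\<^sub>R grad (mollify K u) x) < 0"
    have W: "grad (mollify K u) x \<in> W"
      using x s unfolding W_def by (intro image_eqI[of _ _ "s *\<^sub>R grad (mollify K u) x"]) auto
    have near: "H p < 0" if "norm (p - grad (mollify K u) x) < \<eta>" for p
    proof -
      have "p \<in> ball (grad (mollify K u) x) \<eta>" using that by (simp add: dist_norm norm_minus_commute)
      with W \<eta>(2) show ?thesis by blast
    qed
    have "AE y in lborel. norm (y - x) \<le> \<epsilon> \<longrightarrow> (A y, y) \<in> {(M, y). sym_mat M \<and> f y - lam \<le> F M}"
      using ae_Lebesgue_point
    proof (elim eventually_mono, intro impI)
      fix y assume leb: "\<forall>e>0. \<exists>d>0. \<forall>h. 0 < h \<and> h < d \<longrightarrow>
          (LINT z|lborel. indicator (cbox y (y + h *\<^sub>R One)) z * norm (A z - A y)) \<le> e * h ^ CARD('n)"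
        and y: "norm (y - x) \<le> \<epsilon>"
      have "f y - lam \<le> F (A y)"
        by (rule supersolution_at_Lebesgue_point[OF sup F cf K \<epsilon>(1) near \<epsilon>(2) y leb])
      then show "(A y, y) \<in> {(M, y). sym_mat M \<and> f y - lam \<le> F M}" using A_sym by simp
    qed
    from mollify_mean_in_closed_convex[OF K closed_operator_superlevel[OF F cf]
        convex_operator_superlevel[OF F f] this]
    show "f x - lam \<le> F (hessian (mollify K u) x)" by simp
  qed
qed

end

lemma bounded_hessianI:
  fixes u :: "real^'n::finite \<Rightarrow> real"
  assumes "continuous_on UNIV u" "bounded_weak_hessian u"
  obtains A C B where "bounded_hessian u A C B"
proof -
  obtain A0 C0 where A0 [measurable]: "A0 \<in> borel_measurable borel" and sym: "\<And>x. sym_mat (A0 x)"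
    and bd: "AE x in lborel. norm (A0 x) \<le> C0"
    and weak: "\<And>\<phi> i j. test_function \<phi> \<Longrightarrow>
      (LINT x|lborel. u x * hessian \<phi> x $ i $ j) = (LINT x|lborel. A0 x $ i $ j * \<phi> x)"
    using assms(2) unfolding bounded_weak_hessian_def by auto
  obtain B where B: "\<And>\<rho>. 0 < \<rho> \<Longrightarrow> \<exists>K :: real^'n \<Rightarrow> real. mollifier B \<rho> K"
    using mollifier_exists by blast
  \<comment> \<open>Only a null set is changed, and the value 0 keeps symmetry;
    \<open>max C0 0\<close> lets the bound cover that value.\<close>
  define A where "A x = (if norm (A0 x) \<le> C0 then A0 x else 0)" for x
  have [measurable]: "A \<in> borel_measurable borel" unfolding A_def by measurable
  have "bounded_hessian u A (max C0 0) B"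
  proof
    show "sym_mat (A x)" for x using sym by (simp add: A_def transpose_def vec_eq_iff)
    show "norm (A x) \<le> max C0 0" for x by (auto simp: A_def)
    show "(LINT x|lborel. u x * hessian \<phi> x $ i $ j) = (LINT x|lborel. A x $ i $ j * \<phi> x)"
      if "test_function \<phi>" for \<phi> i j
    proof -
      have c: "continuous_on UNIV \<phi>" by (rule test_function_continuous[OF that])
      have [measurable]: "\<phi> \<in> borel_measurable borel" by (rule borel_measurable_continuous_onI[OF c])
      have nth [measurable]: "(\<lambda>M::real^'n^'n. M $ i $ j) \<in> borel_measurable borel"
        by (intro borel_measurable_continuous_onI continuous_intros)
      have "(LINT x|lborel. A0 x $ i $ j * \<phi> x) = (LINT x|lborel. A x $ i $ j * \<phi> x)"
      proof (rule integral_cong_AE)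
        show "AE x in lborel. A0 x $ i $ j * \<phi> x = A x $ i $ j * \<phi> x"
          using bd by (elim eventually_mono) (simp add: A_def)
      qed (use measurable_compose[OF A0 nth] measurable_compose[OF \<open>A \<in> _\<close> nth] in simp_all)
      then show ?thesis using weak[OF that] by simp
    qed
    show "\<exists>K :: real^'n \<Rightarrow> real. mollifier B \<rho> K" if "0 < \<rho>" for \<rho> using B[OF that] .
  qed (use assms in auto)
  then show thesis by (rule that)
qed

lemma lambda_plus_le:
  fixes F :: "real^'n::finite^'n \<Rightarrow> real"
  assumes F: "admissible_operator F" and H: "admissible_gradient_constraint H"
    and f: "convex_on UNIV f" "superlinear f"
    and eig: "eigenfunction F H f lam u" and bw: "bounded_weak_hessian u"
  shows "lambda_plus F H f \<le> ereal lam"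
proof -
  have u: "continuous_on UNIV u" "viscosity_supersolution F H f lam u"
    "((\<lambda>x. u x / support_fun H x) \<longlongrightarrow> 1) at_infinity"
    using eig by (auto simp: eigenfunction_def)
  obtain A C B where "bounded_hessian u A C B" using bounded_hessianI[OF u(1) bw] .
  then interpret bounded_hessian u A C B .
  obtain m where m: "\<And>x. m \<le> f x" using superlinear_convex_bounded_below[OF f] by blast
  \<comment> \<open>Where the constraint on \<psi> is strict,
    \<open>- s * F (hessian U x) + f x\<close> is at most \<open>s * lam - (s - 1) * f x\<close>,
    and \<open>f\<close> is bounded below by \<open>m\<close>.\<close>
  have bound: "lambda_plus F H f \<le> ereal (s * lam - (s - 1) * m)" if s: "1 < s" for s
  proof -
    obtain U D where U: "C2 U" "\<And>x. \<bar>U x - u x\<bar> \<le> D"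
      "\<And>x. H (s *\<^sub>R grad U x) < 0 \<Longrightarrow> f x - lam \<le> F (hessian U x)"
      using mollified_test_function[OF u(2) F H f(1) s] by blast
    define \<psi> where "\<psi> x = s * U x" for x
    have \<psi>: "C2 \<psi>" unfolding \<psi>_def by (rule Ck_cmult[OF U(1)])
    have lim: "((\<lambda>x. \<psi> x / support_fun H x) \<longlongrightarrow> s) at_infinity"
    proof -
      have "((\<lambda>x. (U x - u x) / support_fun H x) \<longlongrightarrow> 0) at_infinity"
      proof (rule Lim_null_comparison)
        show "((\<lambda>x. D / support_fun H x) \<longlongrightarrow> 0) at_infinity"
          by (rule tendsto_divide_0[OF tendsto_const])
            (rule filterlim_at_top_imp_at_infinity[OF filterlim_support_fun[OF H]])
        have "\<forall>\<^sub>F x in at_infinity. 0 < support_fun H x"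
          using filterlim_support_fun[OF H] by (simp add: filterlim_at_top_dense)
        then show "\<forall>\<^sub>F x in at_infinity. norm ((U x - u x) / support_fun H x) \<le> D / support_fun H x"
          by (rule eventually_mono) (simp add: U(2) divide_right_mono)
      qed
      then have "((\<lambda>x. s * (u x / support_fun H x + (U x - u x) / support_fun H x)) \<longlongrightarrow> s * (1 + 0)) at_infinity"
        by (intro tendsto_intros u(3))
      moreover have "(\<lambda>x. s * (u x / support_fun H x + (U x - u x) / support_fun H x)) =
          (\<lambda>x. \<psi> x / support_fun H x)"
        by (simp add: \<psi>_def fun_eq_iff flip: add_divide_distrib)
      ultimately show ?thesis by simp
    qed
    have "1 \<le> Liminf at_infinity (\<lambda>x. ereal (\<psi> x / support_fun H x))"
    proof -
      have "((\<lambda>x. ereal (\<psi> x / support_fun H x)) \<longlongrightarrow> ereal s) at_infinity"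
        using lim by simp
      from lim_imp_Liminf[OF trivial_limit_at_infinity this] s show ?thesis by simp
    qed
    then have "lambda_plus F H f \<le> (SUP x\<in>{x. H (grad \<psi> x) < 0}. ereal (- F (hessian \<psi> x) + f x))"
      unfolding lambda_plus_def using \<psi> by (intro INF_lower) simp
    also have "\<dots> \<le> ereal (s * lam - (s - 1) * m)"
    proof (rule SUP_least, clarify)
      fix x assume "H (grad \<psi> x) < 0"
      then have "f x - lam \<le> F (hessian U x)"
        using U(3) by (simp add: \<psi>_def[abs_def] grad_cmult C2_differentiable[OF U(1)])
      then have "s * (f x - lam) \<le> s * F (hessian U x)" using s by (intro mult_left_mono) auto
      moreover have "F (hessian \<psi> x) = s * F (hessian U x)"
        using s operator_homogeneous[OF F sym_mat_hessian[OF U(1)]]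
        by (simp add: \<psi>_def[abs_def] hessian_cmult[OF U(1)])
      moreover have "(s - 1) * m \<le> (s - 1) * f x" using m s by (intro mult_left_mono) auto
      ultimately show "ereal (- F (hessian \<psi> x) + f x) \<le> ereal (s * lam - (s - 1) * m)"
        by (simp add: algebra_simps)
    qed
    finally show ?thesis .
  qed
  show ?thesis
  proof (rule ccontr)
    assume "\<not> ?thesis"
    then obtain \<mu> where \<mu>: "ereal lam < ereal \<mu>" "ereal \<mu> < lambda_plus F H f"
      unfolding not_le by (blast dest: ereal_dense2)
    have "\<mu> \<le> lam"
    proof (rule le_of_scaled_bound)
      fix t :: real assume t: "0 < t" "t < 1"
      \<comment> \<open>With \<open>s = 1 / t\<close>, multiplying by \<open>t\<close> restores the
        form used for the other two inequalities.\<close>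
      have "ereal \<mu> < ereal (1 / t * lam - (1 / t - 1) * m)"
        by (rule less_le_trans[OF \<mu>(2) bound]) (use t in simp)
      then have "t * \<mu> \<le> t * (1 / t * lam - (1 / t - 1) * m)"
        using t by (intro mult_left_mono) auto
      also have "\<dots> = lam - (1 - t) * m" using t by (simp add: field_simps)
      finally show "t * \<mu> + (1 - t) * m \<le> lam" by simp
    qed
    with \<mu>(1) show False by simp
  qed
qed

theorem theorem1p3:
  fixes F :: "real^'n^'n \<Rightarrow> real"
    and H f :: "real^'n \<Rightarrow> real"
    and lam :: real
  assumes "admissible_operator F"
    and "admissible_gradient_constraint H"
    and "convex_on UNIV f"
    and "superlinear f"
    and "is_eigenvalue F H f lam"
  shows "lambda_minus F H f \<le> ereal lam \<and> ereal lam \<le> lambda_plus F H f \<and>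
    ((\<exists>u. eigenfunction F H f lam u \<and> bounded_weak_hessian u) \<longrightarrow> ereal lam = lambda_plus F H f)"
  using lambda_minus_le[OF assms] le_lambda_plus[OF assms] lambda_plus_le[OF assms(1-4)]
  by (blast intro: antisym)

end
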